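(* Let $(X,\mathcal{M},\mu)$, $V=\mathrm{span}\{v_1,\dots,v_N\}$, $P_+$, $d_{\mathrm{TV}}$, the SCSP algorithm and the admissible perturbation sets $P_\tau(\mu_M,\Sigma)$ be as defined in the context. Let $\mu_M=\sum_{m=1}^M w_m\delta_{x_m}$ be a measure with $M>N$ distinct support points $x_m\in X$ and weights $w_m>0$, and let $\Sigma=(x_1,\dots,x_M)$ be an ordering of $\mathrm{supp}(\mu_M)$. Assume that: (i) $V$ is a Chebyshev system with respect to $\mu_M$, i.e. $\det\big((v_n(x_m))_{m\in S,\,n\in[N]}\big)\neq 0$ for every $S\subset[M]$ with $|S|=N$; (ii) the same basis $v_1,\dots,v_N$ of $V$ is used in every run of the SCSP algorithm (for every input measure and ordering); (iii) the SCSP algorithm is run with $k=1$ and with the minimum-ratio selection rule (both as built into the description in the context); (iv) in the run of the SCSP algorithm on $(\mu_M,V,\Sigma)$, the minimization problem $\min_{m\in S,\ n_m\neq 0} w_m/|n_m|$ has a unique minimizer at every iteration. Let $\nu=\mathrm{SCSP}(\mu_M,V,\Sigma)$ and fix any $\tau>0$. Then there exist constants $\delta_0=\delta_0(\mu_M,\Sigma,\tau)>0$ and $C=C(\mu_M,\Sigma,\tau)>0$ such that for every $(\widetilde\mu_M,\widetilde\Sigma)\in P_\tau(\mu_M,\Sigma)$ with $d_{\mathrm{TV}}(\mu_M,\widetilde\mu_M)<\delta_0$, the output $\widetilde\nu=\mathrm{SCSP}(\widetilde\mu_M,V,\widetilde\Sigma)$ satisfies $$d_{\mathrm{TV}}(\nu,\widetilde\nu)\le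 C\,d_{\mathrm{TV}}(\mu_M,\widetilde\mu_M).$$
   Context: Notation: $[M]=\{1,\dots,M\}$. For a matrix $A$ and an index set $S$, $A_{S*}$ is the submatrix of rows indexed by $S$; for a vector $b$, $b_S$ is the subvector indexed by $S$. Setting: $(X,\mathcal{M},\mu)$ is a measure space with $\mu$ a positive measure; $V=\mathrm{span}\{v_1,\dots,v_N\}$ is an $N$-dimensional subspace of $L^1_\mu(X)$ with basis functions $v_j:X\to\mathbb{R}$, assumed continuous so that point values $v(x)$, $v\in V$, $x\in X$, are well defined. $(X,\mathcal M,\mu)$, $V$ and the basis are fixed throughout, and $\|v\|_{L^1(X)}$ denotes the norm of $L^1_\mu(X)$. Discrete measures: $P$ is the set of finitely supported signed measures $\sum_{m\in[M]}a_m\delta_{x_m}$ with $M\in\mathbb{N}$, $a_m\in\mathbb{R}$, $x_m\in X$; $P_+\subset P$ is the subset of those with all $a_m\ge 0$. For $\gamma=\sum_m d_m\delta_{x_m}\in P$ (distinct $x_m$), $|\gamma|=\sum_m|d_m|$. For $\alpha,\beta\in P_+$ (not both zero), $$d_{\mathrm{TV}}(\alpha,\beta)=\frac{|\alpha-\beta|}{|\alpha|+|\beta|}.$$ SCSP algorithm (streaming Carathéodory–Steinitz pruning, with $k=1$ and minimum-ratio selection). Input: a measure $\sum_{m\in[M']} w_m\delta_{x_m}$ with $M'>N$ distinct support points and $w_m>0$, the space $V$ (with its basis), and an ordering $(x_1,\dots,x_{M'})$ of the support. Let $\mathbf V\in\mathbb{R}^{M'\times N}$ have entries $\mathbf V_{m,n}=v_n(x_m)$.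 1. Set $S=\{1,\dots,N+1\}$ and let the queue be $(N+2,\dots,M')$. 2. While the queue is non-empty or $|S|>N$: (a) compute a nonzero vector $\mathbf n\in\ker(\mathbf V_{S*}^T)$, with entries $n_m$ indexed by $m\in S$; (b) choose $m^*\in\mathrm{argmin}_{m\in S,\ n_m\neq0}\, w_m/|n_m|$ and set $c=w_{m^*}/n_{m^*}$; (c) replace $\mathbf w_S$ by $\mathbf w_S-c\,\mathbf n$ and let $Z=\{q\in S: w_q=0\}$; (d) replace $S$ by $S\setminus Z$, then remove the first $\min(|Z|,\text{length of queue})$ indices from the queue and add them to $S$. 3. Output the measure $\sum_{m\in S}w_m\delta_{x_m}$, denoted $\mathrm{SCSP}(\cdot,V,\cdot)$ of the input measure and ordering. The choice of $\mathbf n$ and of the minimizer in (b), when not unique, is arbitrary. Under hypotheses (i)–(iv) of the claim, the output for $(\mu_M,V,\Sigma)$ is uniquely determined. Admissible perturbations: for $\tau>0$ define $$X_\tau=\Big\{x\in X:\ \sup_{v\in V\setminus\{0\}}\frac{|v(x)|}{\|v\|_{L^1(X)}}\le\frac1\tau\Big\}.$$ $P_\tau(\mu_M,\Sigma)$ is the set of pairs $(\widetilde\mu,\widetilde\Sigma)$ where $\widetilde\mu\in P_+$, $\widetilde\Sigma$ is an ordering of $\mathrm{supp}(\widetilde\mu)$ whose first $M$ entries, in order, are exactly $\Sigma$ (so $\mathrm{supp}(\mu_M)\subset\mathrm{supp}(\widetilde\mu)$), and $\mathrm{supp}(\widetilde\mu)\setminus\mathrm{supp}(\mu_M)\subset X_\tau$.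 *)

theory Defs
  imports
    "HOL-Analysis.Bochner_Integration"
    "HOL-Library.Poly_Mapping"
    "Jordan_Normal_Form.Determinant"
begin

section \<open>The function space\<close>

text \<open>Basis functions are indexed by \<open>0, \<dots>, N - 1\<close>, and \<open>X\<close> is the space of the measure
  \<open>\<mu>\<close>, with the topology it inherits from the ambient type.  Linear independence is that of
  classes in \<open>L\<^sup>1\<close>, so that the span is an \<open>N\<close>-dimensional subspace of \<open>L\<^sup>1\<close> and a member of the
  span is zero in \<open>L\<^sup>1\<close> only if it is the zero function.\<close>

definition continuous_L1_basis ::
    "('a::topological_space) measure \<Rightarrow> nat \<Rightarrow> (nat \<Rightarrow> 'a \<Rightarrow> real) \<Rightarrow> bool" where
  "continuous_L1_basis \<mu> N v \<longleftrightarrow>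
     (\<forall>j<N. continuous_on (space \<mu>) (v j) \<and> integrable \<mu> (v j)) \<and>
     (\<forall>c :: nat \<Rightarrow> real. (AE x in \<mu>. (\<Sum>j<N. c j * v j x) = 0) \<longrightarrow> (\<forall>j<N. c j = 0))"

definition fun_span :: "nat \<Rightarrow> (nat \<Rightarrow> 'a \<Rightarrow> real) \<Rightarrow> ('a \<Rightarrow> real) set" where
  "fun_span N v = range (\<lambda>c :: nat \<Rightarrow> real. \<lambda>x. \<Sum>j<N. c j * v j x)"

definition L1_norm :: "'a measure \<Rightarrow> ('a \<Rightarrow> real) \<Rightarrow> real" where
  "L1_norm \<mu> f = (LINT x|\<mu>. \<bar>f x\<bar>)"

text \<open>The supremum is taken in the extended reals, as it may be infinite.\<close>

definition X_tau :: "'a measure \<Rightarrow> nat \<Rightarrow> (nat \<Rightarrow> 'a \<Rightarrow> real) \<Rightarrow> real \<Rightarrow> 'a set" where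
  "X_tau \<mu> N v \<tau> =
     {x \<in> space \<mu>. (SUP f \<in> fun_span N v - {\<lambda>_. 0}. ereal (\<bar>f x\<bar> / L1_norm \<mu> f)) \<le> ereal (1 / \<tau>)}"

section \<open>Finitely supported measures\<close>

text \<open>The measure \<open>\<Sum>\<^sub>m a\<^sub>m \<delta>\<^bsub>x\<^sub>m\<^esub>\<close> is the finitely supported function
  \<open>\<Sum>\<^sub>m Poly_Mapping.single x\<^sub>m a\<^sub>m\<close>; its support is \<open>Poly_Mapping.keys\<close>.\<close>

definition discrete_pos :: "'a set \<Rightarrow> ('a \<Rightarrow>\<^sub>0 real) set" where
  "discrete_pos X = {\<alpha>. Poly_Mapping.keys \<alpha> \<subseteq> X \<and> (\<forall>x. 0 \<le> Poly_Mapping.lookup \<alpha> x)}"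

definition total_mass :: "('a \<Rightarrow>\<^sub>0 real) \<Rightarrow> real" where
  "total_mass \<gamma> = (\<Sum>x\<in>Poly_Mapping.keys \<gamma>. \<bar>Poly_Mapping.lookup \<gamma> x\<bar>)"

definition d_TV :: "('a \<Rightarrow>\<^sub>0 real) \<Rightarrow> ('a \<Rightarrow>\<^sub>0 real) \<Rightarrow> real" where
  "d_TV \<alpha> \<beta> = total_mass (\<alpha> - \<beta>) / (total_mass \<alpha> + total_mass \<beta>)"

definition is_ordering :: "'a list \<Rightarrow> 'a set \<Rightarrow> bool" where
  "is_ordering xs A \<longleftrightarrow> distinct xs \<and> set xs = A"

definition admissible_perturbations ::
    "'a measure \<Rightarrow> nat \<Rightarrow> (nat \<Rightarrow> 'a \<Rightarrow> real) \<Rightarrow> real \<Rightarrow> ('a \<Rightarrow>\<^sub>0 real) \<Rightarrow> 'a list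
      \<Rightarrow> (('a \<Rightarrow>\<^sub>0 real) \<times> 'a list) set" where
  "admissible_perturbations \<mu> N v \<tau> \<alpha> xs =
     {(\<beta>, ys). \<beta> \<in> discrete_pos (space \<mu>) \<and> is_ordering ys (Poly_Mapping.keys \<beta>) \<and>
               take (length xs) ys = xs \<and> Poly_Mapping.keys \<beta> - Poly_Mapping.keys \<alpha> \<subseteq> X_tau \<mu> N v \<tau>}"

section \<open>Streaming Caratheodory-Steinitz pruning\<close>

definition point_matrix :: "(nat \<Rightarrow> 'a \<Rightarrow> real) \<Rightarrow> 'a list \<Rightarrow> nat \<Rightarrow> nat \<Rightarrow> real" where
  "point_matrix v xs m j = v j (xs ! m)"

text \<open>Rows are listed in increasing order of their index.\<close>

definition chebyshev_system :: "nat \<Rightarrow> (nat \<Rightarrow> 'a \<Rightarrow> real) \<Rightarrow> 'a list \<Rightarrow> bool" where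
  "chebyshev_system N v xs \<longleftrightarrow>
     (\<forall>S. S \<subseteq> {..<length xs} \<and> card S = N \<longrightarrow>
        Determinant.det
          (mat N N (\<lambda>(i, j). point_matrix v xs (sorted_list_of_set S ! i) j)) \<noteq> 0)"

text \<open>A nonzero vector, with entries indexed by \<open>S\<close>, in the kernel of the transpose of the
  rows \<open>S\<close> of the matrix \<open>A\<close> with \<open>N\<close> columns.\<close>

definition kernel_vector ::
    "nat \<Rightarrow> (nat \<Rightarrow> nat \<Rightarrow> real) \<Rightarrow> nat set \<Rightarrow> (nat \<Rightarrow> real) \<Rightarrow> bool" where
  "kernel_vector N A S n \<longleftrightarrow> (\<forall>j<N. (\<Sum>m\<in>S. A m j * n m) = 0) \<and> (\<exists>m\<in>S. n m \<noteq> 0)"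

definition min_ratio :: "(nat \<Rightarrow> real) \<Rightarrow> nat set \<Rightarrow> (nat \<Rightarrow> real) \<Rightarrow> nat \<Rightarrow> bool" where
  "min_ratio w S n = is_arg_min (\<lambda>m. w m / \<bar>n m\<bar>) (\<lambda>m. m \<in> S \<and> n m \<noteq> 0)"

text \<open>A state consists of the weights, the active index set and the queue; points are numbered
  from \<open>0\<close>.  Since the kernel vector and the minimizer may be chosen arbitrarily, one iteration is
  a relation between states, and an input may have several outputs.\<close>

type_synonym scsp_state = "(nat \<Rightarrow> real) \<times> nat set \<times> nat list"

fun scsp_running :: "nat \<Rightarrow> scsp_state \<Rightarrow> bool" where
  "scsp_running N (w, S, q) \<longleftrightarrow> q \<noteq> [] \<or> card S > N"

inductive scsp_step :: "nat \<Rightarrow> (nat \<Rightarrow> nat \<Rightarrow> real) \<Rightarrow> scsp_state \<Rightarrow> scsp_state \<Rightarrow> bool"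
  for N A where
  "\<lbrakk> scsp_running N (w, S, q);
     kernel_vector N A S n;
     min_ratio w S n ms;
     c = w ms / n ms;
     w' = (\<lambda>m. if m \<in> S then w m - c * n m else w m);
     Z = {m \<in> S. w' m = 0};
     r = min (card Z) (length q) \<rbrakk>
   \<Longrightarrow> scsp_step N A (w, S, q) (w', (S - Z) \<union> set (take r q), drop r q)"

definition scsp_init :: "nat \<Rightarrow> ('a \<Rightarrow>\<^sub>0 real) \<Rightarrow> 'a list \<Rightarrow> scsp_state" where
  "scsp_init N \<alpha> xs = (\<lambda>m. Poly_Mapping.lookup \<alpha> (xs ! m), {0..<N + 1}, [N + 1..<length xs])"

definition scsp_reachable ::
    "nat \<Rightarrow> (nat \<Rightarrow> 'a \<Rightarrow> real) \<Rightarrow> ('a \<Rightarrow>\<^sub>0 real) \<Rightarrow> 'a list \<Rightarrow> scsp_state \<Rightarrow> bool" where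
  "scsp_reachable N v \<alpha> xs = (scsp_step N (point_matrix v xs))\<^sup>*\<^sup>* (scsp_init N \<alpha> xs)"

text \<open>\<open>\<nu>\<close> is an output of a terminated run on the measure \<open>\<alpha>\<close> with the ordering \<open>xs\<close> of its
  support.\<close>

definition scsp_output ::
    "nat \<Rightarrow> (nat \<Rightarrow> 'a \<Rightarrow> real) \<Rightarrow> ('a \<Rightarrow>\<^sub>0 real) \<Rightarrow> 'a list \<Rightarrow> ('a \<Rightarrow>\<^sub>0 real) \<Rightarrow> bool" where
  "scsp_output N v \<alpha> xs \<nu> \<longleftrightarrow>
     (\<exists>w S q. scsp_reachable N v \<alpha> xs (w, S, q) \<and> \<not> scsp_running N (w, S, q) \<and>
        \<nu> = (\<Sum>m\<in>S. Poly_Mapping.single (xs ! m) (w m)))"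

definition unique_minimizers ::
    "nat \<Rightarrow> (nat \<Rightarrow> 'a \<Rightarrow> real) \<Rightarrow> ('a \<Rightarrow>\<^sub>0 real) \<Rightarrow> 'a list \<Rightarrow> bool" where
  "unique_minimizers N v \<alpha> xs \<longleftrightarrow>
     (\<forall>w S q n. scsp_reachable N v \<alpha> xs (w, S, q) \<and> scsp_running N (w, S, q) \<and>
        kernel_vector N (point_matrix v xs) S n \<longrightarrow> (\<exists>!m. min_ratio w S n m))"

section \<open>Every admissible input has an output\<close>

lemma kernel_vector_exists:
  assumes "finite S" "card S > N"
  shows "\<exists>n. kernel_vector N A S n"
  using assms
proof (induction N arbitrary: S A)
  case 0
  then obtain p where "p \<in> S"
    by (metis card_gt_0_iff ex_in_conv)
  then show ?case
    by (auto simp: kernel_vector_def intro!: exI[of _ "\<lambda>_. 1"])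
next
  case (Suc N)
  show ?case
  proof (cases "\<forall>m\<in>S. A m N = 0")
    case True
    obtain n where "kernel_vector N A S n"
      using Suc by (meson Suc_lessD)
    with True have "kernel_vector (Suc N) A S n"
      by (auto simp: kernel_vector_def less_Suc_eq)
    then show ?thesis by blast
  next
    case False
    then obtain p where p: "p \<in> S" "A p N \<noteq> 0" by blast
    define B where "B m j = A m j - A m N * A p j / A p N" for m j
    have "card (S - {p}) > N" using Suc.prems p by simp
    then obtain n where n: "kernel_vector N B (S - {p}) n"
      using Suc.IH[of "S - {p}" B] Suc.prems by blast
    define k where "k = - (\<Sum>m\<in>S - {p}. A m N * n m) / A p N"
    have split: "(\<Sum>m\<in>S. A m j * (n(p := k)) m) = (\<Sum>m\<in>S - {p}. A m j * n m) + A p j * k" for j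
      using Suc.prems p by (subst sum.remove[of _ p]) (auto intro!: sum.cong)
    have "(\<Sum>m\<in>S - {p}. A m j * n m) + A p j * k = (\<Sum>m\<in>S - {p}. B m j * n m)" for j
      by (simp add: B_def k_def left_diff_distrib right_diff_distrib sum_subtractf sum_distrib_left
          sum_divide_distrib mult_ac)
    moreover have "(\<Sum>m\<in>S - {p}. A m N * n m) + A p N * k = 0"
      using p by (simp add: k_def)
    moreover have "\<exists>m\<in>S. (n(p := k)) m \<noteq> 0"
      using n by (auto simp: kernel_vector_def)
    ultimately have "kernel_vector (Suc N) A S (n(p := k))"
      using n by (auto simp: kernel_vector_def less_Suc_eq split simp del: fun_upd_apply)
    then show ?thesis by blast
  qed
qed

fun scsp_invariant :: "nat \<Rightarrow> scsp_state \<Rightarrow> bool" where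
  "scsp_invariant N (w, S, q) \<longleftrightarrow>
     finite S \<and> distinct q \<and> set q \<inter> S = {} \<and> (\<forall>m\<in>S \<union> set q. w m > 0) \<and>
     (q \<noteq> [] \<longrightarrow> card S = N + 1) \<and> card S \<le> N + 1"

lemma scsp_step_exists:
  assumes inv: "scsp_invariant N (w, S, q)" and run: "scsp_running N (w, S, q)"
  shows "\<exists>w' S' q'. scsp_step N A (w, S, q) (w', S', q') \<and> scsp_invariant N (w', S', q') \<and>
           card S' + length q' < card S + length q"
proof -
  have S: "finite S" "card S = N + 1" "card S > N" using inv run by auto
  obtain n where n: "kernel_vector N A S n"
    using kernel_vector_exists S by blast
  have "finite {m \<in> S. n m \<noteq> 0}" "{m \<in> S. n m \<noteq> 0} \<noteq> {}"
    using S n by (auto simp: kernel_vector_def)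
  then obtain ms where "is_arg_min (\<lambda>m. w m / \<bar>n m\<bar>) (\<lambda>m. m \<in> {m \<in> S. n m \<noteq> 0}) ms"
    using ex_is_arg_min_if_finite by blast
  then have ms: "min_ratio w S n ms" by (simp add: min_ratio_def)
  define c where "c = w ms / n ms"
  define w' where "w' = (\<lambda>m. if m \<in> S then w m - c * n m else w m)"
  define Z where "Z = {m \<in> S. w' m = 0}"
  define r where "r = min (card Z) (length q)"
  have msS: "ms \<in> S" "n ms \<noteq> 0" using ms by (auto simp: min_ratio_def is_arg_min_def)
  then have "ms \<in> Z" by (simp add: Z_def w'_def c_def)
  have Z: "Z \<subseteq> S" "finite Z" "card Z > 0"
    using S \<open>ms \<in> Z\<close> by (auto simp: Z_def card_gt_0_iff)
  have nonneg: "w' m \<ge> 0" if m: "m \<in> S" for m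
  proof (cases "n m = 0")
    case True
    then show ?thesis using m inv by (auto simp: w'_def less_imp_le)
  next
    case False
    have "w ms / \<bar>n ms\<bar> \<le> w m / \<bar>n m\<bar>"
      using ms m False by (force simp: min_ratio_def is_arg_min_def)
    moreover have "w ms > 0" using inv msS by auto
    ultimately have "\<bar>c\<bar> \<le> w m / \<bar>n m\<bar>" by (simp add: c_def)
    then have "\<bar>c * n m\<bar> \<le> w m"
      using False by (simp add: pos_le_divide_eq abs_mult)
    then show ?thesis using m by (simp add: w'_def)
  qed
  have pos: "w' m > 0" if "m \<in> (S - Z) \<union> set q" for m
  proof (cases "m \<in> S")
    case True
    with that inv have "m \<in> S - Z" by auto
    then show ?thesis using nonneg[of m] by (auto simp: Z_def)
  next
    case False
    with that inv show ?thesis by (auto simp: w'_def)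
  qed
  have disj: "(S - Z) \<inter> set (take r q) = {}"
    using inv set_take_subset[of r q] by auto
  have card_SZ: "card (S - Z) = card S - card Z" "card Z \<le> card S"
    using Z S card_mono[of S Z] by (auto simp: card_Diff_subset)
  have card_take: "card (set (take r q)) = r"
    using inv by (simp add: distinct_card r_def)
  have card': "card ((S - Z) \<union> set (take r q)) = card S - card Z + r"
    using disj S card_SZ card_take by (simp add: card_Un_disjoint)
  have "set (take r q) \<inter> set (drop r q) = {}"
    using inv by (simp add: set_take_disj_set_drop_if_distinct)
  then have "scsp_invariant N (w', (S - Z) \<union> set (take r q), drop r q)"
    using inv S pos card' card_SZ set_take_subset[of r q] set_drop_subset[of r q]
    by (auto simp: r_def min_def subset_iff)
  moreover have "scsp_step N A (w, S, q) (w', (S - Z) \<union> set (take r q), drop r q)"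
    using run n ms c_def w'_def Z_def r_def by (rule scsp_step.intros)
  moreover have "card ((S - Z) \<union> set (take r q)) + length (drop r q) < card S + length q"
    using card' card_SZ Z by (simp add: r_def)
  ultimately show ?thesis by blast
qed

lemma scsp_terminates:
  assumes "scsp_invariant N (w, S, q)"
  shows "\<exists>w' S' q'. (scsp_step N A)\<^sup>*\<^sup>* (w, S, q) (w', S', q') \<and> \<not> scsp_running N (w', S', q')"
  using assms
proof (induction "card S + length q" arbitrary: w S q rule: less_induct)
  case less
  show ?case
  proof (cases "scsp_running N (w, S, q)")
    case True
    then show ?thesis
      using scsp_step_exists[OF less.prems True, of A] less.hyps
      by (meson converse_rtranclp_into_rtranclp)
  next
    case False
    then show ?thesis by blast
  qed
qed

lemma scsp_output_exists:
  assumes "\<alpha> \<in> discrete_pos X" "is_ordering xs (Poly_Mapping.keys \<alpha>)" "length xs > N"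
  shows "\<exists>\<nu>. scsp_output N v \<alpha> xs \<nu>"
proof -
  have "Poly_Mapping.lookup \<alpha> (xs ! m) > 0" if "m < length xs" for m
    using assms that nth_mem[OF that]
    by (auto simp: discrete_pos_def is_ordering_def in_keys_iff order_less_le)
  then have "scsp_invariant N (scsp_init N \<alpha> xs)"
    using assms(3) by (auto simp: scsp_init_def)
  then show ?thesis
    using scsp_terminates unfolding scsp_output_def scsp_reachable_def scsp_init_def by blast
qed

end

theory Submission
  imports Defs
begin

text \<open>By the Chebyshev property the kernel met at every iteration on the original points is a line,
  so the minimum-ratio choice is intrinsic.  As the minimizer is strict, it survives small changes of
  the weights, and each iteration is Lipschitz in the weights: the perturbed run follows the original
  one until only \<open>N\<close> original points are left, all with weights bounded away from zero.  From then
  on each additional point enters with a tiny weight, while membership in \<open>X_tau\<close> bounds its kernel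
  vector on the other points; so it is removed again at once, and the weights of the \<open>N\<close> points
  change by at most a constant times the weight removed.  The constants are
  obtained by induction along the original run, backwards from its end.\<close>

section \<open>Kernels of unisolvent point sets\<close>

text \<open>The \<open>b m\<close> are coefficients of Lagrange functions in the span, with value 1
  at the point \<open>m\<close> and 0 at the other points of \<open>S\<close>. This is linear
  independence of the rows in \<open>S\<close>, in a form that can be paired with kernel equations
  and yields explicit bounds.\<close>

definition unisolvent :: "nat \<Rightarrow> (nat \<Rightarrow> nat \<Rightarrow> real) \<Rightarrow> nat set \<Rightarrow> bool" where
  "unisolvent N A S \<longleftrightarrow>
     (\<exists>b. \<forall>m\<in>S. \<forall>m'\<in>S. (\<Sum>j<N. b m j * A m' j) = (if m' = m then 1 else 0))"

lemma unisolvent_if_det_nonzero: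
  fixes A :: "nat \<Rightarrow> nat \<Rightarrow> real"
  assumes "finite S" "card S = N"
    and det: "Determinant.det (mat N N (\<lambda>(i, j). A (sorted_list_of_set S ! i) j)) \<noteq> 0"
  shows "unisolvent N A S"
proof -
  define s where "s = sorted_list_of_set S"
  define D where "D = mat N N (\<lambda>(i, j). A (s ! i) j)"
  define idx where "idx = the_inv_into {..<N} ((!) s)"
  have bij: "bij_betw ((!) s) {..<N} S"
    by (rule bij_betw_nth) (use assms(1,2) in \<open>auto simp: s_def\<close>)
  have idx: "idx m < N" if "m \<in> S" for m
    using bij_betw_apply[OF bij_betw_the_inv_into[OF bij] that] by (simp add: idx_def)
  have s_idx: "s ! idx m = m" if "m \<in> S" for m
    unfolding idx_def by (rule f_the_inv_into_f_bij_betw[OF bij that])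
  have D: "D \<in> carrier_mat N N" by (simp add: D_def)
  \<comment> \<open>A column of the inverse of \<open>D\<close>, as adjugate over determinant; that
    \<open>D * adj_mat D\<close> is the determinant times the identity gives the Lagrange
    conditions. \<open>idx m\<close> is the row of \<open>m\<close> in the sorted list.\<close>
  define b where "b m j = adj_mat D $$ (j, idx m) / Determinant.det D" for m j
  have "(\<Sum>j<N. b m j * A m' j) = (if m' = m then 1 else 0)" if m: "m \<in> S" "m' \<in> S" for m m'
  proof -
    have "(\<Sum>j<N. D $$ (idx m', j) * adj_mat D $$ (j, idx m)) = (D * adj_mat D) $$ (idx m', idx m)"
      using D adj_mat(1)[OF D] idx m by (simp add: scalar_prod_def lessThan_atLeast0)
    also have "\<dots> = (if m' = m then Determinant.det D else 0)"
      using adj_mat(2)[OF D] idx s_idx m by (auto, metis)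
    finally have "(\<Sum>j<N. A m' j * adj_mat D $$ (j, idx m)) = (if m' = m then Determinant.det D else 0)"
      using idx s_idx m by (simp add: D_def)
    then show ?thesis
      using det by (simp add: b_def D_def s_def sum_divide_distrib[symmetric] mult.commute split: if_splits)
  qed
  then show ?thesis unfolding unisolvent_def by blast
qed

text \<open>Pairing the equations with the Lagrange coefficients of \<open>m\<close> isolates
  \<open>u m\<close>. The constant comes from these coefficients alone, so it serves every
  right-hand side at once.\<close>

lemma unisolvent_bounded_solution:
  assumes "unisolvent N A S" "finite S"
  shows "\<exists>K\<ge>0. \<forall>u y B. (\<forall>j<N. (\<Sum>m\<in>S. A m j * u m) = y j \<and> \<bar>y j\<bar> \<le> B) \<longrightarrow> (\<forall>m\<in>S. \<bar>u m\<bar> \<le> K * B)"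
proof -
  obtain b where b: "\<And>m m'. m \<in> S \<Longrightarrow> m' \<in> S \<Longrightarrow> (\<Sum>j<N. b m j * A m' j) = (if m' = m then 1 else 0)"
    using assms unfolding unisolvent_def by blast
  define K where "K = (\<Sum>m\<in>S. \<Sum>j<N. \<bar>b m j\<bar>)"
  have K: "(\<Sum>j<N. \<bar>b m j\<bar>) \<le> K" if "m \<in> S" for m
    unfolding K_def using assms(2) that by (intro member_le_sum) (auto intro: sum_nonneg)
  have "\<bar>u m\<bar> \<le> K * B"
    if y: "\<And>j. j < N \<Longrightarrow> (\<Sum>m\<in>S. A m j * u m) = y j" and B: "\<And>j. j < N \<Longrightarrow> \<bar>y j\<bar> \<le> B" and m: "m \<in> S"
    for u y B m
  proof -
    have "(\<Sum>j<N. b m j * y j) = (\<Sum>j<N. \<Sum>m'\<in>S. b m j * (A m' j * u m'))"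
      using y by (intro sum.cong) (auto simp: sum_distrib_left[symmetric])
    also have "\<dots> = (\<Sum>m'\<in>S. u m' * (\<Sum>j<N. b m j * A m' j))"
      by (subst sum.swap) (simp add: sum_distrib_left mult_ac)
    also have "\<dots> = (\<Sum>m'\<in>S. if m' = m then u m' else 0)"
      using b m by (intro sum.cong) auto
    also have "\<dots> = u m" using m assms(2) by simp
    finally have "\<bar>u m\<bar> \<le> (\<Sum>j<N. \<bar>b m j * y j\<bar>)" by (metis sum_abs)
    also have "\<dots> \<le> (\<Sum>j<N. \<bar>b m j\<bar> * B)"
      using B by (intro sum_mono) (auto simp: abs_mult intro: mult_left_mono)
    also have "\<dots> = (\<Sum>j<N. \<bar>b m j\<bar>) * B" by (simp add: sum_distrib_right)
    \<comment> \<open>Only an actual equation forces \<open>B \<ge> 0\<close>; for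
      \<open>N = 0\<close> both sides are zero, as \<open>K\<close> is a sum of empty sums.\<close>
    also have "\<dots> \<le> K * B"
    proof (cases "N = 0")
      case False
      then have "B \<ge> 0" using B[of 0] by linarith
      then show ?thesis using K[OF m] by (intro mult_right_mono)
    qed (simp add: K_def)
    finally show ?thesis .
  qed
  moreover have "K \<ge> 0" by (auto simp: K_def intro: sum_nonneg)
  ultimately show ?thesis by (intro exI[of _ K]) auto
qed

lemma unisolvent_kernel_trivial:
  assumes "unisolvent N A S" "finite S" "\<And>j. j < N \<Longrightarrow> (\<Sum>m\<in>S. A m j * u m) = 0" "m \<in> S"
  shows "u m = 0"
proof -
  obtain K where
    K: "\<forall>u y B. (\<forall>j<N. (\<Sum>m\<in>S. A m j * u m) = y j \<and> \<bar>y j\<bar> \<le> B) \<longrightarrow> (\<forall>m\<in>S. \<bar>u m\<bar> \<le> K * B)"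
    using unisolvent_bounded_solution[OF assms(1,2)] by blast
  show ?thesis using K[rule_format, of u "\<lambda>_. 0" 0 m] assms(3,4) by simp
qed

text \<open>A zero at \<open>p\<close> would leave a linear relation among the independent rows of
  \<open>S - {p}\<close>, so all other entries would vanish too.\<close>

lemma kernel_vector_entry_nonzero:
  assumes "kernel_vector N A S n" "finite S" "p \<in> S" "unisolvent N A (S - {p})"
  shows "n p \<noteq> 0"
proof
  assume p: "n p = 0"
  have "(\<Sum>m\<in>S - {p}. A m j * n m) = 0" if "j < N" for j
    using assms that p by (simp add: kernel_vector_def sum.remove[of S p])
  then have "n m = 0" if "m \<in> S - {p}" for m
    using unisolvent_kernel_trivial[OF assms(4), of n m] assms(2) that by simp
  then show False using assms(1) p by (auto simp: kernel_vector_def)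
qed

text \<open>Scaling \<open>n\<close> to agree with \<open>n'\<close> at \<open>p\<close> gives a
  difference that solves the kernel equations and vanishes at \<open>p\<close>. No kernel vector
  does so, hence the difference is zero on \<open>S\<close>.\<close>

lemma kernel_vectors_proportional:
  assumes n: "kernel_vector N A S n" and n': "kernel_vector N A S n'"
    and S: "finite S" and p: "p \<in> S" "unisolvent N A (S - {p})"
  shows "\<exists>t. t \<noteq> 0 \<and> (\<forall>m\<in>S. n' m = t * n m)"
proof -
  have nz: "n p \<noteq> 0" "n' p \<noteq> 0"
    using kernel_vector_entry_nonzero[OF _ S p] n n' by auto
  define t where "t = n' p / n p"
  have "(\<Sum>m\<in>S. A m j * (n' m - t * n m)) = 0" if "j < N" for j
  proof -
    have "(\<Sum>m\<in>S. A m j * (n' m - t * n m)) = (\<Sum>m\<in>S. A m j * n' m) - t * (\<Sum>m\<in>S. A m j * n m)"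
      by (simp add: right_diff_distrib sum_subtractf sum_distrib_left mult_ac)
    then show ?thesis using n n' that by (simp add: kernel_vector_def)
  qed
  moreover have "\<not> kernel_vector N A S (\<lambda>m. n' m - t * n m)"
    using kernel_vector_entry_nonzero[OF _ S p, of "\<lambda>m. n' m - t * n m"] nz by (auto simp: t_def)
  ultimately have "n' m = t * n m" if "m \<in> S" for m
    using that by (auto simp: kernel_vector_def)
  moreover have "t \<noteq> 0" using nz by (simp add: t_def)
  ultimately show ?thesis by blast
qed

lemma kernel_vector_cong:
  assumes "\<And>m j. m \<in> S \<Longrightarrow> j < N \<Longrightarrow> A m j = A' m j"
  shows "kernel_vector N A S n \<longleftrightarrow> kernel_vector N A' S n"
proof -
  have "(\<Sum>m\<in>S. A m j * n m) = (\<Sum>m\<in>S. A' m j * n m)" if "j < N" for j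
    using assms[OF _ that] by (intro sum.cong) auto
  then show ?thesis by (simp add: kernel_vector_def)
qed

lemma unisolvent_cong:
  assumes "\<And>m j. m \<in> S \<Longrightarrow> j < N \<Longrightarrow> A m j = A' m j"
  shows "unisolvent N A S \<longleftrightarrow> unisolvent N A' S"
proof -
  have "(\<Sum>j<N. b m j * A m' j) = (\<Sum>j<N. b m j * A' m' j)" if "m' \<in> S" for b :: "nat \<Rightarrow> nat \<Rightarrow> real" and m m'
    using assms[OF that] by (intro sum.cong) auto
  then show ?thesis by (simp add: unisolvent_def)
qed

section \<open>Iterations with a strict minimizer\<close>

text \<open>Quantifying over all kernel vectors makes the pivot a property of the weights and the
  active set, not of the arbitrary choice of \<open>n\<close>. The cross-multiplied inequality also
  makes sense where \<open>n m = 0\<close>; there it says that \<open>w m\<close> is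
  positive.\<close>

definition strict_pivot ::
    "nat \<Rightarrow> (nat \<Rightarrow> nat \<Rightarrow> real) \<Rightarrow> (nat \<Rightarrow> real) \<Rightarrow> nat set \<Rightarrow> nat \<Rightarrow> bool" where
  "strict_pivot N A w S p \<longleftrightarrow> p \<in> S \<and> w p > 0 \<and> (\<forall>n. kernel_vector N A S n \<longrightarrow>
     n p \<noteq> 0 \<and> (\<forall>m\<in>S - {p}. w p * \<bar>n m\<bar> < w m * \<bar>n p\<bar>))"

text \<open>A strict minimizer is the only point at which the updated weight vanishes.\<close>

lemma scsp_step_pivot:
  assumes step: "scsp_step N A (w, S, q) st'"
    and pivot: "strict_pivot N A w S p"
  shows "\<exists>n. kernel_vector N A S n \<and>
    st' = (\<lambda>m. if m \<in> S then w m - w p / n p * n m else w m,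
           (S - {p}) \<union> set (take 1 q), drop 1 q)"
  using step
proof (cases rule: scsp_step.cases)
  case (1 n ms c w' Z r)
  have p: "p \<in> S" "w p > 0" and np: "n p \<noteq> 0"
    and less: "\<And>m. m \<in> S - {p} \<Longrightarrow> w p * \<bar>n m\<bar> < w m * \<bar>n p\<bar>"
    using pivot 1(3) by (auto simp: strict_pivot_def)
  have ms: "ms \<in> S" "n ms \<noteq> 0" "\<not> w p / \<bar>n p\<bar> < w ms / \<bar>n ms\<bar>"
    using 1(4) p np by (auto simp: min_ratio_def is_arg_min_def)
  have "ms = p"
  proof (rule ccontr)
    assume "ms \<noteq> p"
    with less[of ms] ms np show False by (simp add: field_simps)
  qed
  \<comment> \<open>A second vanishing weight would mean equality of the two ratios in absolute
    value, against strictness.\<close>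
  have nz: "w m - w p / n p * n m \<noteq> 0" if "m \<in> S - {p}" for m
  proof
    assume "w m - w p / n p * n m = 0"
    then have "w m * n p = w p * n m" using np by (simp add: field_simps)
    then have "\<bar>w m\<bar> * \<bar>n p\<bar> = w p * \<bar>n m\<bar>" using p by (metis abs_mult abs_of_pos)
    moreover have "w m * \<bar>n p\<bar> \<le> \<bar>w m\<bar> * \<bar>n p\<bar>" by (simp add: mult_right_mono)
    ultimately show False using less[OF that] by simp
  qed
  have w': "w' = (\<lambda>m. if m \<in> S then w m - w p / n p * n m else w m)"
    unfolding 1(6) 1(5) \<open>ms = p\<close> ..
  have "w' p = 0" using p np by (simp add: w')
  then have "Z = {p}" unfolding 1(7) using nz p by (auto simp: w')
  moreover have "take (min 1 (length q)) q = take 1 q" "drop (min 1 (length q)) q = drop 1 q"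
    by (cases q; simp)+
  ultimately have "st' = (\<lambda>m. if m \<in> S then w m - w p / n p * n m else w m,
            (S - {p}) \<union> set (take 1 q), drop 1 q)"
    unfolding 1(1) w'[symmetric] 1(8) by simp
  then show ?thesis using 1(3) by blast
qed

text \<open>A partial-correctness assertion: it covers every terminated run, hence every choice of
  kernel vectors and minimizers, so outputs can be bounded without being unique.\<close>

definition ends_in ::
    "nat \<Rightarrow> (nat \<Rightarrow> nat \<Rightarrow> real) \<Rightarrow> scsp_state \<Rightarrow> (scsp_state \<Rightarrow> bool) \<Rightarrow> bool" where
  "ends_in N A st P \<longleftrightarrow> (\<forall>st'. (scsp_step N A)\<^sup>*\<^sup>* st st' \<and> \<not> scsp_running N st' \<longrightarrow> P st')"

lemma ends_in_step:
  assumes "scsp_running N st" "\<And>st'. scsp_step N A st st' \<Longrightarrow> ends_in N A st' P"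
  shows "ends_in N A st P"
  using assms unfolding ends_in_def by (metis converse_rtranclpE)

lemma scsp_step_running: "scsp_step N A st st' \<Longrightarrow> scsp_running N st"
  by (auto elim: scsp_step.cases)

lemma ends_in_terminal:
  assumes "\<not> scsp_running N st" "P st"
  shows "ends_in N A st P"
  using assms scsp_step_running unfolding ends_in_def by (metis converse_rtranclpE)

lemma ends_in_mono:
  assumes "ends_in N A st P" "\<And>st'. P st' \<Longrightarrow> P' st'"
  shows "ends_in N A st P'"
  using assms unfolding ends_in_def by blast

text \<open>The light points of \<open>Q\<close> are pruned one after the other, since their kernel vectors are
  at most \<open>K\<close> times as large on \<open>S\<close> as at the added point.\<close>

lemma light_points_pruned:
  fixes w :: "nat \<Rightarrow> real"
  assumes S: "finite S" "card S = N" and K: "K \<ge> 0"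
    and "distinct Q" "set Q \<inter> S = {}"
    and ker: "\<And>p n. p \<in> set Q \<Longrightarrow> kernel_vector N A (insert p S) n \<Longrightarrow>
            n p \<noteq> 0 \<and> (\<forall>m\<in>S. \<bar>n m\<bar> \<le> K * \<bar>n p\<bar>)"
    and "\<And>p. p \<in> set Q \<Longrightarrow> w p > 0"
    and "\<And>m. m \<in> S \<Longrightarrow> w m > K * sum w (set Q)"
  shows "ends_in N A (w, S \<union> set (take 1 Q), drop 1 Q)
           (\<lambda>(u, T, _). T = S \<and> (\<forall>m\<in>S. \<bar>w m - u m\<bar> \<le> K * sum w (set Q)))"
  using assms(4-)
proof (induction Q arbitrary: w)
  case Nil
  then show ?case using S by (auto intro: ends_in_terminal)
next
  case (Cons p Q)
  have p: "p \<notin> S" "p \<notin> set Q" "w p > 0" using Cons.prems by auto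
  have pos: "sum w (set Q) \<ge> 0" using Cons.prems by (intro sum_nonneg less_imp_le) auto
  have sum: "sum w (set (p # Q)) = w p + sum w (set Q)" using p by simp
  show ?case
  proof (rule ends_in_step)
    show "scsp_running N (w, S \<union> set (take 1 (p # Q)), drop 1 (p # Q))"
      using S p by simp
    fix st assume "scsp_step N A (w, S \<union> set (take 1 (p # Q)), drop 1 (p # Q)) st"
    then have step: "scsp_step N A (w, insert p S, Q) st" by simp
    \<comment> \<open>The reserve on \<open>S\<close> makes \<open>p\<close> the pivot:
      \<open>w p * \<bar>n m\<bar> \<le> K * w p * \<bar>n p\<bar>\<close>, and
      \<open>K * w p\<close> is already below \<open>w m\<close>.\<close>
    have dom: "n p \<noteq> 0 \<and> (\<forall>m\<in>insert p S - {p}. w p * \<bar>n m\<bar> < w m * \<bar>n p\<bar>)"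
      if n: "kernel_vector N A (insert p S) n" for n
    proof -
      have k: "n p \<noteq> 0" "\<And>m. m \<in> S \<Longrightarrow> \<bar>n m\<bar> \<le> K * \<bar>n p\<bar>"
        using Cons.prems(3)[OF _ n] by auto
      have "w p * \<bar>n m\<bar> < w m * \<bar>n p\<bar>" if m: "m \<in> S" for m
      proof -
        have "w p * \<bar>n m\<bar> \<le> w p * (K * \<bar>n p\<bar>)" using k m p by (intro mult_left_mono) auto
        also have "\<dots> = (K * w p) * \<bar>n p\<bar>" by simp
        also have "K * w p \<le> K * (w p + sum w (set Q))" using K pos by (intro mult_left_mono) auto
        also have "\<dots> < w m" using Cons.prems(5)[OF m] sum by simp
        finally show ?thesis using k by (simp add: mult_right_mono)
      qed
      then show ?thesis using k by auto
    qed
    then have "strict_pivot N A w (insert p S) p" using p by (simp add: strict_pivot_def)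
    then obtain n where n: "kernel_vector N A (insert p S) n"
      and st: "st = (\<lambda>m. if m \<in> insert p S then w m - w p / n p * n m else w m,
            (insert p S - {p}) \<union> set (take 1 Q), drop 1 Q)"
      using scsp_step_pivot[OF step] by blast
    have np: "n p \<noteq> 0" using dom[OF n] by simp
    define u where "u = (\<lambda>m. if m \<in> insert p S then w m - w p / n p * n m else w m)"
    have uw: "\<bar>w m - u m\<bar> \<le> K * w p" if m: "m \<in> S" for m
    proof -
      have "\<bar>w m - u m\<bar> = w p / \<bar>n p\<bar> * \<bar>n m\<bar>" using m p by (simp add: u_def abs_mult)
      also have "\<dots> \<le> w p / \<bar>n p\<bar> * (K * \<bar>n p\<bar>)"
        using Cons.prems(3)[OF _ n] m p by (intro mult_left_mono) auto
      finally show ?thesis using np by (simp add: mult.commute)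
    qed
    have uQ: "u m = w m" if "m \<in> set Q" for m
      using that Cons.prems p by (auto simp: u_def)
    then have sumQ: "sum u (set Q) = sum w (set Q)" by simp
    have "ends_in N A (u, S \<union> set (take 1 Q), drop 1 Q)
           (\<lambda>(u', T, _). T = S \<and> (\<forall>m\<in>S. \<bar>u m - u' m\<bar> \<le> K * sum u (set Q)))"
    proof (rule Cons.IH)
      \<comment> \<open>Removing \<open>p\<close> costs \<open>m\<close> at most
        \<open>K * w p\<close>, which is exactly what the required reserve loses when
        \<open>p\<close> leaves the queue.\<close>
      show "u m > K * sum u (set Q)" if "m \<in> S" for m
        using uw[OF that] Cons.prems(5)[OF that] sum sumQ by (simp add: distrib_left)
    qed (use Cons.prems uQ in auto)
    \<comment> \<open>The changes add up: \<open>K * w p\<close> from this step and \<open>K\<close>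
      times the remaining light mass from the later ones.\<close>
    then have "ends_in N A (u, S \<union> set (take 1 Q), drop 1 Q)
           (\<lambda>(u', T, _). T = S \<and> (\<forall>m\<in>S. \<bar>w m - u' m\<bar> \<le> K * sum w (set (p # Q))))"
    proof (rule ends_in_mono, clarsimp simp del: set_simps)
      fix u' m assume "\<forall>m\<in>S. \<bar>u m - u' m\<bar> \<le> K * sum u (set Q)" "m \<in> S"
      then show "\<bar>w m - u' m\<bar> \<le> K * sum w (set (p # Q))"
        using uw[of m] sumQ unfolding sum by (force simp: distrib_left)
    qed
    then show "ends_in N A st (\<lambda>(u', T, _). T = S \<and> (\<forall>m\<in>S. \<bar>w m - u' m\<bar> \<le> K * sum w (set (p # Q))))"
      using st p by (simp add: u_def)
  qed
qed

section \<open>Stability along a run\<close>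

text \<open>The rows of \<open>A\<close> with index below \<open>M\<close> belong to the given points, and \<open>Q\<close> lists the indices
  of the additional ones.\<close>

definition perturbs ::
    "nat \<Rightarrow> nat \<Rightarrow> real \<Rightarrow> (nat \<Rightarrow> nat \<Rightarrow> real) \<Rightarrow> (nat \<Rightarrow> real) \<Rightarrow> real
      \<Rightarrow> (nat \<Rightarrow> nat \<Rightarrow> real) \<Rightarrow> (nat \<Rightarrow> real) \<Rightarrow> nat list \<Rightarrow> bool" where
  "perturbs N M B A w \<epsilon> A' w' Q \<longleftrightarrow>
     (\<forall>m<M. \<forall>j<N. A' m j = A m j) \<and> (\<forall>m<M. \<bar>w m - w' m\<bar> \<le> \<epsilon>) \<and> distinct Q \<and>
     (\<forall>m\<in>set Q. M \<le> m \<and> 0 < w' m \<and> (\<forall>j<N. \<bar>A' m j\<bar> \<le> B)) \<and> sum w' (set Q) \<le> \<epsilon>"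

text \<open>While the unperturbed run is active, \<open>card S = N + 1\<close> and the additional points wait at the
  end of the queue; once it has stopped with \<open>card S = N\<close>, the first of them is in the active set.\<close>

fun stable ::
    "nat \<Rightarrow> nat \<Rightarrow> real \<Rightarrow> (nat \<Rightarrow> nat \<Rightarrow> real) \<Rightarrow> (nat \<Rightarrow> real) \<Rightarrow> nat set \<Rightarrow> scsp_state \<Rightarrow> bool" where
  "stable N M B A u T (w, S, q) \<longleftrightarrow>
     (\<exists>\<delta>>0. \<exists>L\<ge>0. \<forall>\<epsilon> A' w' Q. perturbs N M B A w \<epsilon> A' w' Q \<and> \<epsilon> < \<delta> \<longrightarrow>
        ends_in N A' (w', S \<union> set (take (N + 1 - card S) Q), q @ drop (N + 1 - card S) Q)
          (\<lambda>(u', T', _). T' = T \<and> (\<forall>m\<in>T. \<bar>u m - u' m\<bar> \<le> L * \<epsilon>)))"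

section \<open>Stability once the original run has stopped\<close>

lemma finite_uniform_delta:
  fixes P :: "'b \<Rightarrow> real \<Rightarrow> bool"
  assumes "finite S" "\<And>m. m \<in> S \<Longrightarrow> \<exists>\<delta>>0. \<forall>\<epsilon><\<delta>. P m \<epsilon>"
  shows "\<exists>\<delta>>0. \<forall>\<epsilon><\<delta>. \<forall>m\<in>S. P m \<epsilon>"
  using assms
proof (induction S rule: finite_induct)
  case empty
  then show ?case by (auto intro: exI[of _ 1])
next
  case (insert x S)
  then obtain d e where "d > 0" "\<forall>\<epsilon><d. P x \<epsilon>" "e > 0" "\<forall>\<epsilon><e. \<forall>m\<in>S. P m \<epsilon>" by (metis insertCI)
  then show ?case by (intro exI[of _ "min d e"]) auto
qed

text \<open>Base of the backward induction: only additional points are left to process. A kernel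
  vector on \<open>insert p S\<close> solves the equations on \<open>S\<close> with right-hand side
  \<open>- (A' p j * n p)\<close>, so its entries there are at most
  \<open>K * B * \<bar>n p\<bar>\<close>, and \<open>light_points_pruned\<close> applies.\<close>

lemma stable_terminal:
  assumes S: "S \<subseteq> {..<M}" "card S = N" "unisolvent N A S" and w: "\<And>m. m \<in> S \<Longrightarrow> w m > 0"
    and B: "B \<ge> 0"
  shows "stable N M B A w S (w, S, [])"
proof -
  have fin: "finite S" using S(1) finite_subset by blast
  obtain K where K: "K \<ge> 0" and
    bound: "\<forall>u y B. (\<forall>j<N. (\<Sum>m\<in>S. A m j * u m) = y j \<and> \<bar>y j\<bar> \<le> B) \<longrightarrow> (\<forall>m\<in>S. \<bar>u m\<bar> \<le> K * B)"
    using unisolvent_bounded_solution[OF S(3) fin] by blast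
  define K' where "K' = K * B"
  have K': "K' \<ge> 0" using K B by (simp add: K'_def)
  \<comment> \<open>One \<open>\<epsilon>\<close> pays for the deviation of the perturbed weight,
    and \<open>K' * \<epsilon>\<close> is the reserve needed to prune the light points. The same
    \<open>K' + 1\<close> is the Lipschitz constant.\<close>
  have "\<exists>\<delta>>0. \<forall>\<epsilon><\<delta>. \<forall>m\<in>S. (K' + 1) * \<epsilon> < w m"
  proof (rule finite_uniform_delta[OF fin])
    fix m assume "m \<in> S"
    then show "\<exists>\<delta>>0. \<forall>\<epsilon><\<delta>. (K' + 1) * \<epsilon> < w m"
      using w K' by (intro exI[of _ "w m / (K' + 1)"]) (auto simp: field_simps)
  qed
  then obtain \<delta> where \<delta>: "\<delta> > 0" "\<And>\<epsilon> m. \<epsilon> < \<delta> \<Longrightarrow> m \<in> S \<Longrightarrow> (K' + 1) * \<epsilon> < w m" by blast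
  have "ends_in N A' (w', S \<union> set (take (N + 1 - card S) Q), [] @ drop (N + 1 - card S) Q)
          (\<lambda>(u', T', _). T' = S \<and> (\<forall>m\<in>S. \<bar>w m - u' m\<bar> \<le> (K' + 1) * \<epsilon>))"
    if P: "perturbs N M B A w \<epsilon> A' w' Q" and \<epsilon>: "\<epsilon> < \<delta>" for \<epsilon> A' w' Q
  proof -
    have SM: "m < M" if "m \<in> S" for m using S(1) that by auto
    have QM: "M \<le> m" if "m \<in> set Q" for m using P that by (simp add: perturbs_def)
    have A': "A' m j = A m j" if "m \<in> S" "j < N" for m j
      using P SM that by (simp add: perturbs_def)
    have near: "\<bar>w m - w' m\<bar> \<le> \<epsilon>" if "m \<in> S" for m
      using P SM that by (simp add: perturbs_def)
    have Q: "distinct Q" "set Q \<inter> S = {}" "\<And>m. m \<in> set Q \<Longrightarrow> 0 < w' m"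
        "\<And>m j. m \<in> set Q \<Longrightarrow> j < N \<Longrightarrow> \<bar>A' m j\<bar> \<le> B" "sum w' (set Q) \<le> \<epsilon>"
      using P SM QM by (force simp: perturbs_def)+
    have "ends_in N A' (w', S \<union> set (take 1 Q), drop 1 Q)
           (\<lambda>(u', T, _). T = S \<and> (\<forall>m\<in>S. \<bar>w' m - u' m\<bar> \<le> K' * sum w' (set Q)))"
    proof (rule light_points_pruned[OF fin S(2) K' Q(1,2) _ Q(3)])
      show "K' * sum w' (set Q) < w' m" if "m \<in> S" for m
      proof -
        have "K' * sum w' (set Q) \<le> K' * \<epsilon>" using Q K' by (intro mult_left_mono)
        also have "\<dots> < w' m" using \<delta>(2)[OF \<epsilon> that] near[OF that] by (simp add: algebra_simps)
        finally show ?thesis .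
      qed
      fix p n assume p: "p \<in> set Q" and n: "kernel_vector N A' (insert p S) n"
      have pS: "p \<notin> S" using p Q by auto
      have "insert p S - {p} = S" using pS by auto
      moreover have "unisolvent N A' S" using S(3) unisolvent_cong[of S N A A'] A' by auto
      ultimately have np: "n p \<noteq> 0"
        using kernel_vector_entry_nonzero[OF n, of p] fin by simp
      have eq: "(\<Sum>m\<in>S. A m j * n m) = - (A' p j * n p)" if "j < N" for j
      proof -
        have "(\<Sum>m\<in>S. A m j * n m) = (\<Sum>m\<in>S. A' m j * n m)" using A' that by simp
        then show ?thesis using n that fin pS by (simp add: kernel_vector_def eq_neg_iff_add_eq_0 add.commute)
      qed
      have "\<bar>n m\<bar> \<le> K * (B * \<bar>n p\<bar>)" if "m \<in> S" for m
      proof -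
        have "\<bar>- (A' p j * n p)\<bar> \<le> B * \<bar>n p\<bar>" if "j < N" for j
          using Q(4)[OF p that] by (simp add: abs_mult mult_right_mono)
        then show ?thesis
          using bound[rule_format, of n "\<lambda>j. - (A' p j * n p)" "B * \<bar>n p\<bar>" m] eq that by blast
      qed
      then show "n p \<noteq> 0 \<and> (\<forall>m\<in>S. \<bar>n m\<bar> \<le> K' * \<bar>n p\<bar>)" using np by (simp add: K'_def mult.assoc)
    qed
    then have "ends_in N A' (w', S \<union> set (take 1 Q), drop 1 Q)
           (\<lambda>(u', T, _). T = S \<and> (\<forall>m\<in>S. \<bar>w m - u' m\<bar> \<le> (K' + 1) * \<epsilon>))"
    proof (rule ends_in_mono, clarsimp)
      fix u' m assume *: "\<forall>m\<in>S. \<bar>w' m - u' m\<bar> \<le> K' * sum w' (set Q)" and m: "m \<in> S"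
      have "\<bar>w m - u' m\<bar> \<le> \<epsilon> + K' * sum w' (set Q)" using * m near[OF m] by fastforce
      also have "\<dots> \<le> \<epsilon> + K' * \<epsilon>" using Q K' by (intro add_left_mono mult_left_mono)
      finally show "\<bar>w m - u' m\<bar> \<le> (K' + 1) * \<epsilon>" by (simp add: algebra_simps)
    qed
    \<comment> \<open>Here \<open>N + 1 - card S = 1\<close>: the first additional point has already
      moved from the queue into the active set.\<close>
    then show ?thesis using S(2) by simp
  qed
  moreover have "0 \<le> K' + 1" using K' by simp
  ultimately show ?thesis unfolding stable.simps using \<delta>(1) by meson
qed

text \<open>All entries of a kernel vector are nonzero, so every point of \<open>S\<close> competes
  and uniqueness turns the minimum into a strict one. The kernel is a line, and passing to another
  vector only multiplies both sides of the inequality by \<open>\<bar>t\<bar>\<close>.\<close>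

lemma unique_minimizer_pivot:
  assumes S: "finite S" "card S > N" and w: "\<And>m. m \<in> S \<Longrightarrow> w m > 0"
    and uni: "\<And>p. p \<in> S \<Longrightarrow> unisolvent N A (S - {p})"
    and unique: "\<And>n. kernel_vector N A S n \<Longrightarrow> \<exists>!m. min_ratio w S n m"
  shows "\<exists>p. strict_pivot N A w S p"
proof -
  obtain n where n: "kernel_vector N A S n" using kernel_vector_exists S by blast
  then obtain p where p: "min_ratio w S n p" and only: "\<And>m. min_ratio w S n m \<Longrightarrow> m = p"
    using unique by blast
  have pS: "p \<in> S" "n p \<noteq> 0"
    and le: "\<And>m. m \<in> S \<Longrightarrow> n m \<noteq> 0 \<Longrightarrow> w p / \<bar>n p\<bar> \<le> w m / \<bar>n m\<bar>"
    using p by (force simp: min_ratio_def is_arg_min_def not_less)+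
  have less: "w p * \<bar>n m\<bar> < w m * \<bar>n p\<bar>" if m: "m \<in> S - {p}" for m
  proof -
    have nm: "n m \<noteq> 0" using kernel_vector_entry_nonzero[OF n S(1)] uni m by blast
    have "w p / \<bar>n p\<bar> \<noteq> w m / \<bar>n m\<bar>"
    proof
      assume "w p / \<bar>n p\<bar> = w m / \<bar>n m\<bar>"
      then have "min_ratio w S n m" using p m nm by (simp add: min_ratio_def is_arg_min_def)
      then show False using only m by blast
    qed
    with le[of m] m nm have "w p / \<bar>n p\<bar> < w m / \<bar>n m\<bar>" by simp
    then show ?thesis using nm pS by (simp add: field_simps)
  qed
  have "n' p \<noteq> 0 \<and> (\<forall>m\<in>S - {p}. w p * \<bar>n' m\<bar> < w m * \<bar>n' p\<bar>)"
    if n': "kernel_vector N A S n'" for n'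
  proof -
    obtain t where t: "t \<noteq> 0" "\<And>m. m \<in> S \<Longrightarrow> n' m = t * n m"
      using kernel_vectors_proportional[OF n n' S(1) pS(1) uni[OF pS(1)]] by blast
    have "w p * \<bar>n' m\<bar> < w m * \<bar>n' p\<bar>" if m: "m \<in> S - {p}" for m
    proof -
      have "\<bar>t\<bar> * (w p * \<bar>n m\<bar>) < \<bar>t\<bar> * (w m * \<bar>n p\<bar>)"
        using less[OF m] t(1) by (intro mult_strict_left_mono) auto
      then show ?thesis using t(2)[of m] t(2)[of p] m pS by (simp add: abs_mult mult_ac)
    qed
    then show ?thesis using t pS by simp
  qed
  then show ?thesis using pS w unfolding strict_pivot_def by blast
qed

text \<open>The worst case is \<open>(a + \<epsilon>) * c < (b - \<epsilon>) * d\<close>; solving it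
  for \<open>\<epsilon>\<close> gives the threshold.\<close>

lemma strict_ratio_perturbation:
  fixes a b c d :: real
  assumes "a * c < b * d" "c \<ge> 0" "d > 0"
  shows "\<exists>\<delta>>0. \<forall>\<epsilon><\<delta>. \<forall>a' b'. \<bar>a - a'\<bar> \<le> \<epsilon> \<longrightarrow> \<bar>b - b'\<bar> \<le> \<epsilon> \<longrightarrow> a' * c < b' * d"
proof (intro exI[of _ "(b * d - a * c) / (c + d)"] conjI allI impI)
  show "0 < (b * d - a * c) / (c + d)" using assms by simp
  fix \<epsilon> a' b'
  assume \<epsilon>: "\<epsilon> < (b * d - a * c) / (c + d)" and a: "\<bar>a - a'\<bar> \<le> \<epsilon>" and b: "\<bar>b - b'\<bar> \<le> \<epsilon>"
  have "a' * c \<le> (a + \<epsilon>) * c" "(b - \<epsilon>) * d \<le> b' * d"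
    using a b assms by (auto intro!: mult_right_mono)
  moreover have "\<epsilon> * (c + d) < b * d - a * c"
    using \<epsilon> assms by (simp add: pos_less_divide_eq)
  ultimately show "a' * c < b' * d" by (simp add: algebra_simps)
qed

text \<open>Both runs have the same kernel line on \<open>S\<close> and, for small errors, the same
  pivot. Each update is then \<open>w m - w p * (n m / n p)\<close> with the same factor, linear in
  the weights, while the additional points keep their weights. So the new states are related as
  before, with the error enlarged by a constant factor.\<close>

lemma stable_step:
  assumes S: "S \<subseteq> {..<M}" "card S = N + 1" and q: "set q \<inter> S = {}"
    and pivot: "strict_pivot N A w S p" and uni: "unisolvent N A (S - {p})"
    and step: "scsp_step N A (w, S, q) st" and st: "stable N M B A u T st"
  shows "stable N M B A u T (w, S, q)"
proof -
  have fin: "finite S" using S(1) finite_subset by blast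
  have p: "p \<in> S" "w p > 0" using pivot by (auto simp: strict_pivot_def)
  obtain n where ker_n: "kernel_vector N A S n"
    and st_eq: "st = (\<lambda>m. if m \<in> S then w m - w p / n p * n m else w m,
            (S - {p}) \<union> set (take 1 q), drop 1 q)"
    using scsp_step_pivot[OF step pivot] by blast
  have n: "kernel_vector N A S n" "n p \<noteq> 0"
    and strict: "\<And>m. m \<in> S - {p} \<Longrightarrow> w p * \<bar>n m\<bar> < w m * \<bar>n p\<bar>"
    using pivot ker_n by (auto simp: strict_pivot_def)
  define w1 where "w1 = (\<lambda>m. if m \<in> S then w m - w p / n p * n m else w m)"
  define S1 where "S1 = (S - {p}) \<union> set (take 1 q)"
  \<comment> \<open>With an empty queue the original active set shrinks to \<open>N\<close> points,
    while in the perturbed run the first additional point fills the gap;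
    \<open>N + 1 - card S1\<close> records this.\<close>
  have cardS1: "card S1 = (if q = [] then N else N + 1)"
  proof (cases q)
    case (Cons k q')
    then have "S1 = insert k (S - {p})" "k \<notin> S - {p}" using q by (auto simp: S1_def)
    then show ?thesis using Cons S p fin by simp
  qed (use S p in \<open>simp add: S1_def\<close>)
  obtain \<delta>1 L1 where \<delta>1: "\<delta>1 > 0" "L1 \<ge> 0"
    and ends: "\<forall>\<epsilon> A' w' Q. perturbs N M B A w1 \<epsilon> A' w' Q \<and> \<epsilon> < \<delta>1 \<longrightarrow>
        ends_in N A' (w', S1 \<union> set (take (N + 1 - card S1) Q), drop 1 q @ drop (N + 1 - card S1) Q)
          (\<lambda>(u', T', _). T' = T \<and> (\<forall>m\<in>T. \<bar>u m - u' m\<bar> \<le> L1 * \<epsilon>))"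
    using st unfolding st_eq w1_def[symmetric] S1_def[symmetric] stable.simps by blast
  have "\<exists>\<delta>>0. \<forall>\<epsilon><\<delta>. \<forall>m\<in>S - {p}. \<forall>a b. \<bar>w p - a\<bar> \<le> \<epsilon> \<longrightarrow> \<bar>w m - b\<bar> \<le> \<epsilon> \<longrightarrow> a * \<bar>n m\<bar> < b * \<bar>n p\<bar>"
    using fin strict n by (intro finite_uniform_delta strict_ratio_perturbation) auto
  then obtain \<delta>0 where \<delta>0: "\<delta>0 > 0"
    and less: "\<And>\<epsilon> m a b. \<epsilon> < \<delta>0 \<Longrightarrow> m \<in> S - {p} \<Longrightarrow> \<bar>w p - a\<bar> \<le> \<epsilon> \<Longrightarrow> \<bar>w m - b\<bar> \<le> \<epsilon>
         \<Longrightarrow> a * \<bar>n m\<bar> < b * \<bar>n p\<bar>"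
    by metis
  define L0 where "L0 = 1 + (\<Sum>m\<in>S. \<bar>n m / n p\<bar>)"
  have L0: "L0 \<ge> 1" by (simp add: L0_def sum_nonneg)
  have ratio: "1 + \<bar>n m / n p\<bar> \<le> L0" if "m \<in> S" for m
    unfolding L0_def using member_le_sum[of m S "\<lambda>m. \<bar>n m / n p\<bar>"] fin that by simp
  \<comment> \<open>\<open>\<delta>0\<close> keeps \<open>p\<close> the strict pivot,
    \<open>w p\<close> keeps its perturbed weight positive, and \<open>\<delta>1 / L0\<close> keeps
    the enlarged error within the threshold of the successor state.\<close>
  define \<delta> where "\<delta> = min (min \<delta>0 (w p)) (\<delta>1 / L0)"
  have "ends_in N A' (w', S \<union> set (take (N + 1 - card S) Q), q @ drop (N + 1 - card S) Q)
          (\<lambda>(u', T', _). T' = T \<and> (\<forall>m\<in>T. \<bar>u m - u' m\<bar> \<le> (L1 * L0) * \<epsilon>))"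
    if P: "perturbs N M B A w \<epsilon> A' w' Q" and "\<epsilon> < \<delta>" for \<epsilon> A' w' Q
  proof -
    have \<epsilon>: "\<epsilon> < \<delta>0" "\<epsilon> < w p" "L0 * \<epsilon> < \<delta>1"
      using \<open>\<epsilon> < \<delta>\<close> L0 by (auto simp: \<delta>_def pos_less_divide_eq mult.commute)
    have SM: "m < M" if "m \<in> S" for m using S(1) that by auto
    have near: "\<bar>w m - w' m\<bar> \<le> \<epsilon>" if "m < M" for m using P that by (simp add: perturbs_def)
    have \<epsilon>0: "\<epsilon> \<ge> 0" using near[OF SM[OF p(1)]] by linarith
    have ker: "kernel_vector N A S k" if "kernel_vector N A' S k" for k
      using that kernel_vector_cong[of S N A' A k] P SM by (simp add: perturbs_def)
    have dom': "k p \<noteq> 0 \<and> (\<forall>m\<in>S - {p}. w' p * \<bar>k m\<bar> < w' m * \<bar>k p\<bar>)"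
      if k: "kernel_vector N A' S k" for k
    proof -
      obtain t where t: "t \<noteq> 0" "\<And>m. m \<in> S \<Longrightarrow> k m = t * n m"
        using kernel_vectors_proportional[OF n(1) ker[OF k] fin p(1) uni] by blast
      have "w' p * \<bar>k m\<bar> < w' m * \<bar>k p\<bar>" if m: "m \<in> S - {p}" for m
      proof -
        have "w' p * \<bar>n m\<bar> < w' m * \<bar>n p\<bar>" using less[OF \<epsilon>(1) m] near SM m p by simp
        then have "\<bar>t\<bar> * (w' p * \<bar>n m\<bar>) < \<bar>t\<bar> * (w' m * \<bar>n p\<bar>)"
          using t(1) by (intro mult_strict_left_mono) auto
        then show ?thesis using t(2)[of m] t(2)[of p] m p by (simp add: abs_mult mult_ac)
      qed
      then show ?thesis using t n p by simp
    qed
    have "w' p > 0" using near[OF SM[OF p(1)]] \<epsilon>(2) by linarith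
    with dom' p have pivot': "strict_pivot N A' w' S p" by (simp add: strict_pivot_def)
    have "ends_in N A' (w', S, q @ Q) (\<lambda>(u', T', _). T' = T \<and> (\<forall>m\<in>T. \<bar>u m - u' m\<bar> \<le> (L1 * L0) * \<epsilon>))"
    proof (rule ends_in_step)
      show "scsp_running N (w', S, q @ Q)" using S by simp
      fix st' assume step': "scsp_step N A' (w', S, q @ Q) st'"
      obtain k where k: "kernel_vector N A' S k"
        and st': "st' = (\<lambda>m. if m \<in> S then w' m - w' p / k p * k m else w' m,
            (S - {p}) \<union> set (take 1 (q @ Q)), drop 1 (q @ Q))"
        using scsp_step_pivot[OF step' pivot'] by blast
      define w1' where "w1' = (\<lambda>m. if m \<in> S then w' m - w' p / k p * k m else w' m)"
      obtain t where t: "t \<noteq> 0" "\<And>m. m \<in> S \<Longrightarrow> k m = t * n m"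
        using kernel_vectors_proportional[OF n(1) ker[OF k] fin p(1) uni] by blast
      \<comment> \<open>The scale \<open>t\<close> of the chosen kernel vector cancels in the
        quotient, so the perturbed update uses the ratios of \<open>n\<close>.\<close>
      have w1': "w1' m = w' m - w' p * (n m / n p)" if "m \<in> S" for m
        using t(2)[of m] t(2)[of p] t(1) that p by (simp add: w1'_def)
      have near1: "\<bar>w1 m - w1' m\<bar> \<le> L0 * \<epsilon>" if m: "m < M" for m
      proof (cases "m \<in> S")
        case True
        have "w1 m - w1' m = (w m - w' m) - (w p - w' p) * (n m / n p)"
          using True by (simp add: w1_def w1' left_diff_distrib diff_divide_distrib)
        then have "\<bar>w1 m - w1' m\<bar> \<le> \<bar>w m - w' m\<bar> + \<bar>w p - w' p\<bar> * \<bar>n m / n p\<bar>"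
          by (metis abs_mult abs_triangle_ineq4)
        also have "\<dots> \<le> \<epsilon> + \<epsilon> * \<bar>n m / n p\<bar>"
          using near[OF m] near[OF SM[OF p(1)]] by (intro add_mono mult_right_mono) auto
        also have "\<dots> = (1 + \<bar>n m / n p\<bar>) * \<epsilon>" by (simp add: algebra_simps)
        also have "\<dots> \<le> L0 * \<epsilon>" using ratio[OF True] \<epsilon>0 by (intro mult_right_mono)
        finally show ?thesis .
      next
        case False
        then have "\<bar>w1 m - w1' m\<bar> \<le> 1 * \<epsilon>" using near[OF m] by (simp add: w1_def w1'_def)
        also have "\<dots> \<le> L0 * \<epsilon>" using L0 \<epsilon>0 by (intro mult_right_mono)
        finally show ?thesis .
      qed
      have Q: "m \<notin> S" if "m \<in> set Q" for m using P SM[of m] that by (auto simp: perturbs_def)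
      have w1'Q: "w1' m = w' m" if "m \<in> set Q" for m using Q[OF that] by (simp add: w1'_def)
      have "sum w1' (set Q) \<le> L0 * \<epsilon>"
      proof -
        have "sum w1' (set Q) \<le> 1 * \<epsilon>" using P w1'Q by (simp add: perturbs_def)
        also have "\<dots> \<le> L0 * \<epsilon>" using L0 \<epsilon>0 by (intro mult_right_mono)
        finally show ?thesis .
      qed
      then have "perturbs N M B A w1 (L0 * \<epsilon>) A' w1' Q"
        using P near1 w1'Q by (simp add: perturbs_def)
      from ends[rule_format, OF conjI[OF this \<epsilon>(3)]]
      have "ends_in N A' (w1', S1 \<union> set (take (N + 1 - card S1) Q), drop 1 q @ drop (N + 1 - card S1) Q)
          (\<lambda>(u', T', _). T' = T \<and> (\<forall>m\<in>T. \<bar>u m - u' m\<bar> \<le> L1 * (L0 * \<epsilon>)))" .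
      moreover have "st' = (w1', S1 \<union> set (take (N + 1 - card S1) Q), drop 1 q @ drop (N + 1 - card S1) Q)"
        unfolding st' w1'_def[symmetric] using cardS1 by (cases q) (auto simp: S1_def)
      ultimately show "ends_in N A' st' (\<lambda>(u', T', _). T' = T \<and> (\<forall>m\<in>T. \<bar>u m - u' m\<bar> \<le> (L1 * L0) * \<epsilon>))"
        by (simp add: mult.assoc)
    qed
    then show ?thesis using S by simp
  qed
  moreover have "\<delta> > 0" using \<delta>0 \<delta>1 p L0 by (simp add: \<delta>_def)
  moreover have "0 \<le> L1 * L0" using \<delta>1 L0 by simp
  ultimately show ?thesis unfolding stable.simps by meson
qed

text \<open>A strict pivot leaves all other weights positive and costs only one index per step. This
  supplies the bound \<open>N \<le> card S'\<close>, absent from \<open>scsp_invariant\<close>,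
  which forces exactly \<open>N\<close> points at termination.\<close>

lemma pivot_step_invariant:
  assumes inv: "scsp_invariant N (w, S, q)" "S \<union> set q \<subseteq> {..<M}" and card: "card S = N + 1"
    and pivot: "strict_pivot N A w S p"
    and step: "scsp_step N A (w, S, q) (w', S', q')"
  shows "scsp_invariant N (w', S', q')" "S' \<union> set q' \<subseteq> {..<M}" "N \<le> card S'"
proof -
  have fin: "finite S" and p: "p \<in> S" and wp: "w p > 0"
    using inv pivot by (auto simp: strict_pivot_def)
  obtain n where n: "kernel_vector N A S n"
    and eq: "(w', S', q') = (\<lambda>m. if m \<in> S then w m - w p / n p * n m else w m,
            (S - {p}) \<union> set (take 1 q), drop 1 q)"
    using scsp_step_pivot[OF step pivot] by blast
  have w': "w' m = (if m \<in> S then w m - w p / n p * n m else w m)" for m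
    using eq by simp
  have S': "S' = (S - {p}) \<union> set (take 1 q)" and q': "q' = drop 1 q"
    using eq by auto
  have pos: "w' m > 0" if "m \<in> S - {p}" for m
  proof -
    have "w p / n p * n m \<le> \<bar>w p / n p * n m\<bar>" by (rule abs_ge_self)
    also have "\<dots> = w p / \<bar>n p\<bar> * \<bar>n m\<bar>" using wp by (simp add: abs_mult)
    also have "\<dots> < w m" using pivot n that by (simp add: strict_pivot_def pos_divide_less_eq)
    finally show ?thesis using w'[of m] that by simp
  qed
  have pos_q: "w' m > 0" if "m \<in> set q" for m
  proof -
    have "m \<notin> S" "w m > 0" using inv(1) that by auto
    then show ?thesis using w'[of m] by simp
  qed
  show "S' \<union> set q' \<subseteq> {..<M}" using inv(2) by (cases q) (auto simp: S' q')
  have "scsp_invariant N (w', S', q') \<and> N \<le> card S'"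
  proof (cases q)
    case Nil
    then have "S' = S - {p}" "q' = []" using S' q' by auto
    then show ?thesis using card p fin pos by simp
  next
    case (Cons k r)
    then have S'': "S' = insert k (S - {p})" "q' = r" using S' q' by auto
    have k: "k \<notin> S - {p}" "k \<notin> set r" "distinct r" "set r \<inter> S = {}"
      using inv Cons by auto
    have "card S' = N + 1" using S'' k card p fin by simp
    moreover have "w' m > 0" if "m \<in> S' \<union> set q'" for m
      using that pos pos_q Cons S'' by auto
    moreover have "finite S'" "distinct q'" "set q' \<inter> S' = {}" using S'' k fin by auto
    ultimately show ?thesis by simp
  qed
  then show "scsp_invariant N (w', S', q')" "N \<le> card S'" by auto
qed

text \<open>Stability travels from the final state back to \<open>st\<close> along the run, with
  \<open>u\<close> and \<open>T\<close> fixed. Uniqueness is assumed at all states reachable from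
  \<open>st\<close>, so that it passes to the successor.\<close>

lemma stable_run:
  assumes uni: "\<And>T. T \<subseteq> {..<M} \<Longrightarrow> card T = N \<Longrightarrow> unisolvent N A T" and B: "B \<ge> 0"
    and run: "(scsp_step N A)\<^sup>*\<^sup>* st (u, T, r)" and final: "\<not> scsp_running N (u, T, r)"
    and "scsp_invariant N st" "fst (snd st) \<union> set (snd (snd st)) \<subseteq> {..<M}" "N \<le> card (fst (snd st))"
    and "\<And>w S q n. (scsp_step N A)\<^sup>*\<^sup>* st (w, S, q) \<Longrightarrow> scsp_running N (w, S, q) \<Longrightarrow>
           kernel_vector N A S n \<Longrightarrow> \<exists>!m. min_ratio w S n m"
  shows "stable N M B A u T st \<and> T \<subseteq> {..<M} \<and> card T = N \<and> (\<forall>m\<in>T. u m > 0)"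
  using run assms(5-)
proof (induction rule: converse_rtranclp_induct)
  case base
  \<comment> \<open>Having stopped gives an empty queue and at most \<open>N\<close> points; the
    lower bound on the cardinality gives equality.\<close>
  then have "T \<subseteq> {..<M}" "card T = N" "\<forall>m\<in>T. u m > 0" "r = []" using final by auto
  then show ?case using stable_terminal[OF _ _ uni _ B] by blast
next
  case (step st st1)
  obtain w S q where st: "st = (w, S, q)" by (cases st)
  obtain w1 S1 q1 where st1: "st1 = (w1, S1, q1)" by (cases st1)
  have running: "scsp_running N (w, S, q)" using step.hyps st scsp_step_running by blast
  have inv: "scsp_invariant N (w, S, q)" "S \<union> set q \<subseteq> {..<M}" "N \<le> card S"
    using step.prems st by auto
  have S: "finite S" "card S = N + 1" "S \<subseteq> {..<M}" "set q \<inter> S = {}" "\<And>m. m \<in> S \<Longrightarrow> w m > 0"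
    using inv running by auto
  \<comment> \<open>A running state has \<open>N + 1\<close> active points, so deleting any one
    leaves a set to which the Chebyshev property applies.\<close>
  have uniS: "unisolvent N A (S - {p})" if "p \<in> S" for p
    using S that by (intro uni) auto
  have "\<exists>p. strict_pivot N A w S p"
    using S uniS step.prems(4)[of w S q] running st
    by (intro unique_minimizer_pivot) auto
  then obtain p where pivot: "strict_pivot N A w S p" by blast
  then have p: "p \<in> S" by (simp add: strict_pivot_def)
  have hstep: "scsp_step N A (w, S, q) (w1, S1, q1)" using step.hyps st st1 by simp
  note inv1 = pivot_step_invariant[OF inv(1,2) S(2) pivot hstep]
  have IH: "stable N M B A u T st1 \<and> T \<subseteq> {..<M} \<and> card T = N \<and> (\<forall>m\<in>T. u m > 0)"
  proof (rule step.IH)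
    show "\<exists>!m. min_ratio w S n m" if "(scsp_step N A)\<^sup>*\<^sup>* st1 (w, S, q)"
      "scsp_running N (w, S, q)" "kernel_vector N A S n" for w S q n
      using step.prems(4)[OF converse_rtranclp_into_rtranclp[OF step.hyps(1) that(1)] that(2,3)] .
  qed (use inv1 st1 in auto)
  have "stable N M B A u T (w, S, q)"
    using stable_step[OF S(3,2,4) pivot uniS[OF p] hstep] IH st1 by blast
  then show ?case using IH st by blast
qed

section \<open>Total variation\<close>

text \<open>The function \<open>v j\<close> is itself a competitor in the supremum. Independence
  modulo null sets makes its norm positive, so the quotient can be cleared.\<close>

lemma X_tau_basis_bound:
  assumes basis: "continuous_L1_basis \<mu> N v" and y: "y \<in> X_tau \<mu> N v \<tau>" and j: "j < N"
  shows "\<bar>v j y\<bar> \<le> L1_norm \<mu> (v j) / \<tau>"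
proof -
  have coord: "(\<Sum>i<N. (if i = j then 1 else 0) * v i x) = v j x" for x
  proof -
    have "(\<Sum>i<N. (if i = j then 1 else 0) * v i x) = (\<Sum>i<N. if i = j then v i x else 0)"
      by (intro sum.cong) auto
    then show ?thesis using j by simp
  qed
  have int: "integrable \<mu> (v j)" using basis j by (simp add: continuous_L1_basis_def)
  have not_AE: "\<not> (AE x in \<mu>. v j x = 0)"
  proof
    assume "AE x in \<mu>. v j x = 0"
    then have "AE x in \<mu>. (\<Sum>i<N. (if i = j then 1 else 0) * v i x) = 0" unfolding coord .
    then have "\<forall>i<N. (if i = j then 1 else 0 :: real) = 0"
      using basis[unfolded continuous_L1_basis_def, THEN conjunct2, THEN spec, of "\<lambda>i. if i = j then 1 else 0"]
      by (rule rev_mp)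
    then show False using j by auto
  qed
  have "L1_norm \<mu> (v j) \<noteq> 0"
    using not_AE integral_nonneg_eq_0_iff_AE[of \<mu> "\<lambda>x. \<bar>v j x\<bar>"] int by (simp add: L1_norm_def)
  then have pos: "L1_norm \<mu> (v j) > 0"
    by (simp add: L1_norm_def order_less_le integral_nonneg_AE)
  have "v j \<noteq> (\<lambda>_. 0)" using not_AE by auto
  moreover have "v j \<in> fun_span N v"
    unfolding fun_span_def using coord by (intro image_eqI[of _ _ "\<lambda>i. if i = j then 1 else 0"]) auto
  ultimately have "ereal (\<bar>v j y\<bar> / L1_norm \<mu> (v j))
      \<le> (SUP f \<in> fun_span N v - {\<lambda>_. 0}. ereal (\<bar>f y\<bar> / L1_norm \<mu> f))"
    by (intro SUP_upper) auto
  also have "\<dots> \<le> ereal (1 / \<tau>)" using y by (simp add: X_tau_def)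
  finally have "\<bar>v j y\<bar> / L1_norm \<mu> (v j) \<le> 1 / \<tau>" by simp
  then show ?thesis using pos by (simp add: pos_divide_le_eq)
qed

section \<open>Total mass of finitely supported measures\<close>

lemma total_mass_superset:
  assumes "finite A" "Poly_Mapping.keys \<gamma> \<subseteq> A"
  shows "total_mass \<gamma> = (\<Sum>x\<in>A. \<bar>Poly_Mapping.lookup \<gamma> x\<bar>)"
  unfolding total_mass_def using assms by (intro sum.mono_neutral_left) (auto simp: in_keys_iff)

lemma total_mass_nonneg: "total_mass \<gamma> \<ge> 0"
  by (simp add: total_mass_def sum_nonneg)

lemma abs_lookup_le_total_mass: "\<bar>Poly_Mapping.lookup \<gamma> x\<bar> \<le> total_mass \<gamma>"
proof -
  have "total_mass \<gamma> = (\<Sum>x\<in>insert x (Poly_Mapping.keys \<gamma>). \<bar>Poly_Mapping.lookup \<gamma> x\<bar>)"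
    by (rule total_mass_superset) auto
  then show ?thesis
    using member_le_sum[of x "insert x (Poly_Mapping.keys \<gamma>)" "\<lambda>x. \<bar>Poly_Mapping.lookup \<gamma> x\<bar>"] by simp
qed

lemma total_mass_triangle:
  fixes \<alpha> \<beta> \<gamma> :: "'a \<Rightarrow>\<^sub>0 real"
  assumes "\<And>x. \<bar>Poly_Mapping.lookup \<gamma> x\<bar> \<le> \<bar>Poly_Mapping.lookup \<alpha> x\<bar> + \<bar>Poly_Mapping.lookup \<beta> x\<bar>"
  shows "total_mass \<gamma> \<le> total_mass \<alpha> + total_mass \<beta>"
proof -
  define A where "A = Poly_Mapping.keys \<alpha> \<union> Poly_Mapping.keys \<beta> \<union> Poly_Mapping.keys \<gamma>"
  have "total_mass \<gamma> = (\<Sum>x\<in>A. \<bar>Poly_Mapping.lookup \<gamma> x\<bar>)"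
    "total_mass \<alpha> = (\<Sum>x\<in>A. \<bar>Poly_Mapping.lookup \<alpha> x\<bar>)"
    "total_mass \<beta> = (\<Sum>x\<in>A. \<bar>Poly_Mapping.lookup \<beta> x\<bar>)"
    by (rule total_mass_superset; auto simp: A_def)+
  then show ?thesis using assms by (simp add: sum.distrib[symmetric] sum_mono)
qed

lemma total_mass_sum_single_le:
  assumes "finite S"
  shows "total_mass (\<Sum>m\<in>S. Poly_Mapping.single (y m) (c m)) \<le> (\<Sum>m\<in>S. \<bar>c m\<bar>)"
  using assms
proof (induction S rule: finite_induct)
  case empty
  then show ?case by (simp add: total_mass_def)
next
  case (insert k S)
  have "total_mass (\<Sum>m\<in>insert k S. Poly_Mapping.single (y m) (c m))
      \<le> total_mass (Poly_Mapping.single (y k) (c k)) + total_mass (\<Sum>m\<in>S. Poly_Mapping.single (y m) (c m))"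
    using insert.hyps by (intro total_mass_triangle) (simp add: lookup_add)
  moreover have "total_mass (Poly_Mapping.single (y k) (c k)) = \<bar>c k\<bar>"
    by (simp add: total_mass_def)
  ultimately show ?case using insert by simp
qed

lemma lookup_sum_single:
  assumes "finite S" "inj_on y S" "m \<in> S"
  shows "Poly_Mapping.lookup (\<Sum>k\<in>S. Poly_Mapping.single (y k) (c k)) (y m) = c m"
proof -
  have "Poly_Mapping.lookup (\<Sum>k\<in>S. Poly_Mapping.single (y k) (c k)) (y m)
      = (\<Sum>k\<in>S. if k = m then c k else 0)"
    unfolding lookup_sum using assms
    by (intro sum.cong) (auto simp: lookup_single when_def dest: inj_onD)
  then show ?thesis using assms by simp
qed

text \<open>The denominator of \<open>d_TV\<close> is at most
  \<open>2 * total_mass \<alpha> + total_mass (\<alpha> - \<beta>)\<close>. As the distance is at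
  most 1/2, the second part is absorbed on the left, which doubles the factor 2 to 4.\<close>

lemma total_mass_diff_le_d_TV:
  assumes pos: "total_mass \<alpha> > 0" and d: "d_TV \<alpha> \<beta> \<le> 1 / 2"
  shows "total_mass (\<alpha> - \<beta>) \<le> 4 * total_mass \<alpha> * d_TV \<alpha> \<beta>"
proof -
  have nonneg: "total_mass \<beta> \<ge> 0" "total_mass (\<alpha> - \<beta>) \<ge> 0" by (rule total_mass_nonneg)+
  then have d0: "d_TV \<alpha> \<beta> \<ge> 0" using pos by (simp add: d_TV_def)
  have "total_mass \<beta> \<le> total_mass \<alpha> + total_mass (\<alpha> - \<beta>)"
    by (rule total_mass_triangle) (simp add: lookup_minus)
  moreover have eq: "total_mass (\<alpha> - \<beta>) = d_TV \<alpha> \<beta> * (total_mass \<alpha> + total_mass \<beta>)"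
    using pos nonneg by (simp add: d_TV_def)
  ultimately have "total_mass (\<alpha> - \<beta>) \<le> d_TV \<alpha> \<beta> * (2 * total_mass \<alpha> + total_mass (\<alpha> - \<beta>))"
    using d0 by (metis add.assoc add_left_mono mult_2 mult_left_mono)
  also have "\<dots> = 2 * total_mass \<alpha> * d_TV \<alpha> \<beta> + d_TV \<alpha> \<beta> * total_mass (\<alpha> - \<beta>)"
    by (simp add: algebra_simps)
  also have "d_TV \<alpha> \<beta> * total_mass (\<alpha> - \<beta>) \<le> 1 / 2 * total_mass (\<alpha> - \<beta>)"
    using d nonneg by (intro mult_right_mono)
  finally show ?thesis by simp
qed

theorem theorem4p1:
  fixes \<mu> :: "'a::topological_space measure"
    and N M :: nat
    and v :: "nat \<Rightarrow> 'a \<Rightarrow> real"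
    and x :: "nat \<Rightarrow> 'a" and w :: "nat \<Rightarrow> real"
    and \<mu>\<^sub>M \<nu> :: "'a \<Rightarrow>\<^sub>0 real"
    and xs :: "'a list"
    and \<tau> :: real
  assumes "continuous_L1_basis \<mu> N v"
    and "M > N"
    and "inj_on x {..<M}" and "x ` {..<M} \<subseteq> space \<mu>"
    and "\<forall>m<M. w m > 0"
    and "\<mu>\<^sub>M = (\<Sum>m<M. Poly_Mapping.single (x m) (w m))"
    and "xs = map x [0..<M]"
    and "chebyshev_system N v xs"
    and "unique_minimizers N v \<mu>\<^sub>M xs"
    and "scsp_output N v \<mu>\<^sub>M xs \<nu>"
    and "\<tau> > 0"
  shows "\<exists>\<delta>\<^sub>0>0. \<exists>C>0. \<forall>(\<mu>', xs') \<in> admissible_perturbations \<mu> N v \<tau> \<mu>\<^sub>M xs.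
           d_TV \<mu>\<^sub>M \<mu>' < \<delta>\<^sub>0 \<longrightarrow>
           (\<forall>\<nu>'. scsp_output N v \<mu>' xs' \<nu>' \<longrightarrow> d_TV \<nu> \<nu>' \<le> C * d_TV \<mu>\<^sub>M \<mu>')"
proof -

  \<comment> \<open>Passage from points and measures to rows and weights\<close>
  define A where "A = point_matrix v xs"
  \<comment> \<open>The sum of the bounds for the single basis functions on \<open>X_tau\<close>:
    one bound for all entries in the rows of the additional points.\<close>
  define B where "B = (\<Sum>j<N. L1_norm \<mu> (v j) / \<tau>)"
  have norm_nonneg: "0 \<le> L1_norm \<mu> (v j) / \<tau>" for j
    using assms(11) by (simp add: L1_norm_def integral_nonneg_AE)
  then have B: "B \<ge> 0" by (simp add: B_def sum_nonneg)
  have len: "length xs = M" and xs: "\<And>m. m < M \<Longrightarrow> xs ! m = x m" using assms(7) by auto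
  have inj: "inj_on ((!) xs) {..<M}" using assms(3) xs by (simp add: inj_on_def)
  have mass: "Poly_Mapping.lookup \<mu>\<^sub>M (xs ! m) = w m" if "m < M" for m
    using lookup_sum_single[OF _ assms(3), of m w] that xs by (simp add: assms(6))
  have keys: "Poly_Mapping.keys \<mu>\<^sub>M \<subseteq> set xs"
  proof -
    have "Poly_Mapping.keys \<mu>\<^sub>M \<subseteq> (\<Union>m\<in>{..<M}. Poly_Mapping.keys (Poly_Mapping.single (x m) (w m)))"
      unfolding assms(6) by (rule keys_sum)
    also have "\<dots> \<subseteq> set xs" using assms(7) by (auto split: if_splits)
    finally show ?thesis .
  qed
  have uni: "unisolvent N A T" if "T \<subseteq> {..<M}" "card T = N" for T
    unfolding A_def using assms(8) that len
    by (intro unisolvent_if_det_nonzero) (auto simp: chebyshev_system_def intro: finite_subset)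
  obtain u T r where run: "(scsp_step N A)\<^sup>*\<^sup>* (scsp_init N \<mu>\<^sub>M xs) (u, T, r)"
    and final: "\<not> scsp_running N (u, T, r)"
    and \<nu>: "\<nu> = (\<Sum>m\<in>T. Poly_Mapping.single (xs ! m) (u m))"
    using assms(10) unfolding scsp_output_def scsp_reachable_def A_def by blast
  have "stable N M B A u T (scsp_init N \<mu>\<^sub>M xs) \<and> T \<subseteq> {..<M} \<and> card T = N \<and> (\<forall>m\<in>T. u m > 0)"
  proof (rule stable_run[OF uni B run final])
    show "scsp_invariant N (scsp_init N \<mu>\<^sub>M xs)"
      using assms(2,5) mass len by (auto simp: scsp_init_def)
    show "fst (snd (scsp_init N \<mu>\<^sub>M xs)) \<union> set (snd (snd (scsp_init N \<mu>\<^sub>M xs))) \<subseteq> {..<M}"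
      using assms(2) len by (auto simp: scsp_init_def)
    show "N \<le> card (fst (snd (scsp_init N \<mu>\<^sub>M xs)))" by (simp add: scsp_init_def)
    show "\<exists>!m. min_ratio w S n m" if "(scsp_step N A)\<^sup>*\<^sup>* (scsp_init N \<mu>\<^sub>M xs) (w, S, q)"
      "scsp_running N (w, S, q)" "kernel_vector N A S n" for w S q n
      using assms(9) that unfolding unique_minimizers_def scsp_reachable_def A_def by blast
  qed
  then have T: "T \<subseteq> {..<M}" "card T = N" "\<And>m. m \<in> T \<Longrightarrow> u m > 0"
    and stable: "stable N M B A u T
       (\<lambda>m. Poly_Mapping.lookup \<mu>\<^sub>M (xs ! m), {0..<N + 1}, [N + 1..<M])"
    by (auto simp: scsp_init_def len simp del: stable.simps)
  have finT: "finite T" using T(1) finite_subset by blast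
  have injT: "inj_on ((!) xs) T" using inj T(1) inj_on_subset by blast
  obtain \<delta> L where \<delta>: "\<delta> > 0" and L: "L \<ge> 0"
    and ends: "\<forall>\<epsilon> A' w' Q. perturbs N M B A (\<lambda>m. Poly_Mapping.lookup \<mu>\<^sub>M (xs ! m)) \<epsilon> A' w' Q \<and> \<epsilon> < \<delta> \<longrightarrow>
        ends_in N A' (w', {0..<N + 1} \<union> set (take (N + 1 - card {0..<N + 1}) Q),
            [N + 1..<M] @ drop (N + 1 - card {0..<N + 1}) Q)
          (\<lambda>(u', T', _). T' = T \<and> (\<forall>m\<in>T. \<bar>u m - u' m\<bar> \<le> L * \<epsilon>))"
    using stable unfolding stable.simps by blast
  have mass_pos: "total_mass \<mu>\<^sub>M > 0"
    using abs_lookup_le_total_mass[of \<mu>\<^sub>M "xs ! 0"] mass[of 0] assms(2,5) by auto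
  define K where "K = 4 * total_mass \<mu>\<^sub>M"
  have K: "K > 0" using mass_pos by (simp add: K_def)
  \<comment> \<open>\<open>K\<close> converts distance into mass, \<open>L\<close> is the Lipschitz
    constant for each of the \<open>N\<close> output weights, and the division normalizes by the
    mass of \<open>\<nu>\<close>. The added 1 keeps \<open>C\<close> positive when \<open>N\<close>
    or \<open>L\<close> is zero.\<close>
  define C where "C = real N * L * K / total_mass \<nu> + 1"
  have C: "C > 0" using L K total_mass_nonneg[of \<nu>] by (simp add: C_def add_nonneg_pos)
  \<comment> \<open>The bound 1/2 allows the absorption in \<open>total_mass_diff_le_d_TV\<close>;
    \<open>\<delta> / K\<close> brings the mass of the difference below
    \<open>\<delta>\<close>.\<close>
  have main: "d_TV \<nu> \<nu>' \<le> C * d_TV \<mu>\<^sub>M \<mu>'"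
    if adm: "(\<mu>', xs') \<in> admissible_perturbations \<mu> N v \<tau> \<mu>\<^sub>M xs"
      and d: "d_TV \<mu>\<^sub>M \<mu>' < min (1 / 2) (\<delta> / K)" and out: "scsp_output N v \<mu>' xs' \<nu>'" for \<mu>' xs' \<nu>'
  proof -

    \<comment> \<open>Comparison with one perturbed run\<close>
    define \<epsilon> where "\<epsilon> = total_mass (\<mu>\<^sub>M - \<mu>')"
    define A' where "A' = point_matrix v xs'"
    define w' where "w' = (\<lambda>m. Poly_Mapping.lookup \<mu>' (xs' ! m))"
    define Q where "Q = [M..<length xs']"
    have \<epsilon>: "\<epsilon> \<le> K * d_TV \<mu>\<^sub>M \<mu>'"
      using total_mass_diff_le_d_TV[OF mass_pos] d by (simp add: \<epsilon>_def K_def)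
    also have "\<dots> < \<delta>" using d K by (simp add: pos_less_divide_eq mult.commute)
    finally have \<epsilon>\<delta>: "\<epsilon> < \<delta>" .
    have pos: "\<And>y. Poly_Mapping.lookup \<mu>' y \<ge> 0" and dist: "distinct xs'"
      and keys': "set xs' = Poly_Mapping.keys \<mu>'" and take: "take M xs' = xs"
      and new: "Poly_Mapping.keys \<mu>' - Poly_Mapping.keys \<mu>\<^sub>M \<subseteq> X_tau \<mu> N v \<tau>"
      using adm len by (auto simp: admissible_perturbations_def discrete_pos_def is_ordering_def)
    have len': "M \<le> length xs'" using len take by (metis length_take min.cobounded1 min.commute)
    have old: "xs' ! m = xs ! m" if "m < M" for m using take that by (metis nth_take)
    \<comment> \<open>The ordering is distinct and begins with the original points, so a later entry
      cannot repeat one of them.\<close>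
    have fresh: "xs' ! m \<notin> Poly_Mapping.keys \<mu>\<^sub>M" if m: "m \<in> set Q" for m
    proof
      assume "xs' ! m \<in> Poly_Mapping.keys \<mu>\<^sub>M"
      then obtain i where "i < M" "xs' ! m = xs ! i" using keys len by (metis in_set_conv_nth subsetD)
      then have "xs' ! m = xs' ! i" "i < m" "m < length xs'" using old[of i] m by (auto simp: Q_def)
      then show False using dist nth_eq_iff_index_eq[of xs' m i] by simp
    qed
    have "perturbs N M B A (\<lambda>m. Poly_Mapping.lookup \<mu>\<^sub>M (xs ! m)) \<epsilon> A' w' Q"
      unfolding perturbs_def
    proof (intro conjI allI ballI impI)
      show "A' m j = A m j" if "m < M" for m j
        using old[OF that] by (simp add: A_def A'_def point_matrix_def)
      show "\<bar>Poly_Mapping.lookup \<mu>\<^sub>M (xs ! m) - w' m\<bar> \<le> \<epsilon>" if "m < M" for m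
        using abs_lookup_le_total_mass[of "\<mu>\<^sub>M - \<mu>'" "xs ! m"] old[OF that]
        by (simp add: \<epsilon>_def w'_def lookup_minus)
      show "distinct Q" by (simp add: Q_def)
      show "M \<le> m" if "m \<in> set Q" for m using that by (simp add: Q_def)
      have inkeys: "xs' ! m \<in> Poly_Mapping.keys \<mu>'" if "m \<in> set Q" for m
        using nth_mem[of m xs'] that unfolding keys' by (simp add: Q_def)
      show "0 < w' m" if "m \<in> set Q" for m
        using inkeys[OF that] pos[of "xs' ! m"] by (simp add: w'_def in_keys_iff)
      show "\<bar>A' m j\<bar> \<le> B" if m: "m \<in> set Q" and j: "j < N" for m j
      proof -
        have "xs' ! m \<in> X_tau \<mu> N v \<tau>" using inkeys[OF m] fresh[OF m] new by blast
        then have "\<bar>v j (xs' ! m)\<bar> \<le> L1_norm \<mu> (v j) / \<tau>"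
          using X_tau_basis_bound[OF assms(1)] j by blast
        also have "\<dots> \<le> B"
          unfolding B_def using j norm_nonneg by (intro member_le_sum) auto
        finally show ?thesis by (simp add: A'_def point_matrix_def)
      qed
      \<comment> \<open>The original measure vanishes at the additional points, so their weights are
        values of the difference, and their sum is part of its total mass.\<close>
      have "sum w' (set Q) = (\<Sum>m\<in>set Q. \<bar>Poly_Mapping.lookup (\<mu>\<^sub>M - \<mu>') (xs' ! m)\<bar>)"
        using fresh pos by (intro sum.cong) (auto simp: w'_def lookup_minus in_keys_iff)
      also have "\<dots> = (\<Sum>y\<in>(!) xs' ` set Q. \<bar>Poly_Mapping.lookup (\<mu>\<^sub>M - \<mu>') y\<bar>)"
        using dist by (subst sum.reindex) (auto simp: Q_def inj_on_def nth_eq_iff_index_eq)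
      also have "\<dots> \<le> (\<Sum>y\<in>(!) xs' ` set Q \<union> Poly_Mapping.keys (\<mu>\<^sub>M - \<mu>'). \<bar>Poly_Mapping.lookup (\<mu>\<^sub>M - \<mu>') y\<bar>)"
        by (intro sum_mono2) auto
      also have "\<dots> = \<epsilon>"
        unfolding \<epsilon>_def by (rule total_mass_superset[symmetric]) auto
      finally show "sum w' (set Q) \<le> \<epsilon>" .
    qed
    \<comment> \<open>The initial active set has \<open>N + 1\<close> elements, so none is taken
      from \<open>Q\<close>: all additional points wait behind the original queue.\<close>
    then have ends': "ends_in N A' (w', {0..<N + 1}, [N + 1..<M] @ Q)
          (\<lambda>(u', T', _). T' = T \<and> (\<forall>m\<in>T. \<bar>u m - u' m\<bar> \<le> L * \<epsilon>))"
      using ends[rule_format, OF conjI[OF _ \<epsilon>\<delta>]] by simp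
    have "[N + 1..<M] @ Q = [N + 1..<length xs']"
      using upt_add_eq_append[of "N + 1" M "length xs' - M"] assms(2) len' by (simp add: Q_def)
    then have init: "scsp_init N \<mu>' xs' = (w', {0..<N + 1}, [N + 1..<M] @ Q)"
      by (simp add: scsp_init_def w'_def)
    obtain u' T' r' where "(scsp_step N A')\<^sup>*\<^sup>* (scsp_init N \<mu>' xs') (u', T', r')"
      "\<not> scsp_running N (u', T', r')"
      and \<nu>': "\<nu>' = (\<Sum>m\<in>T'. Poly_Mapping.single (xs' ! m) (u' m))"
      using out unfolding scsp_output_def scsp_reachable_def A'_def by blast
    then have T': "T' = T" and near: "\<And>m. m \<in> T \<Longrightarrow> \<bar>u m - u' m\<bar> \<le> L * \<epsilon>"
      using ends' unfolding ends_in_def init by fastforce+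
    \<comment> \<open>Both outputs live on the same original points, so their difference is computed
      weight by weight.\<close>
    have "\<nu>' = (\<Sum>m\<in>T. Poly_Mapping.single (xs ! m) (u' m))"
      unfolding \<nu>' T' using old T(1) by (intro sum.cong) auto
    then have "\<nu> - \<nu>' = (\<Sum>m\<in>T. Poly_Mapping.single (xs ! m) (u m - u' m))"
      by (simp add: \<nu> sum_subtractf[symmetric] single_diff)
    then have "total_mass (\<nu> - \<nu>') \<le> (\<Sum>m\<in>T. \<bar>u m - u' m\<bar>)"
      using total_mass_sum_single_le[OF finT] by metis
    also have "\<dots> \<le> real N * (L * \<epsilon>)"
      using near sum_bounded_above[of T "\<lambda>m. \<bar>u m - u' m\<bar>" "L * \<epsilon>"] T(2) by simp
    also have "\<dots> \<le> real N * (L * (K * d_TV \<mu>\<^sub>M \<mu>'))"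
      using \<epsilon> L by (intro mult_left_mono) auto
    finally have le: "total_mass (\<nu> - \<nu>') \<le> real N * L * K * d_TV \<mu>\<^sub>M \<mu>'" by (simp add: mult.assoc)
    have d0: "d_TV \<mu>\<^sub>M \<mu>' \<ge> 0" by (simp add: d_TV_def total_mass_nonneg)
    show "d_TV \<nu> \<nu>' \<le> C * d_TV \<mu>\<^sub>M \<mu>'"
    proof (cases "N = 0")
      \<comment> \<open>Without output points both measures are zero, and the quotient
        \<open>0 / 0\<close> in \<open>d_TV\<close> has the value 0.\<close>
      case True
      then have "total_mass (\<nu> - \<nu>') = 0" using le total_mass_nonneg[of "\<nu> - \<nu>'"] by simp
      then have "d_TV \<nu> \<nu>' = 0" by (simp add: d_TV_def)
      then show ?thesis using C d0 by simp
    next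
      case False
      then have "T \<noteq> {}" using T(2) by auto
      then obtain m where m: "m \<in> T" by blast
      then have \<nu>_pos: "total_mass \<nu> > 0"
        using abs_lookup_le_total_mass[of \<nu> "xs ! m"] lookup_sum_single[OF finT injT m, of u] T(3)[OF m]
        by (simp add: \<nu>)
      \<comment> \<open>Omitting the mass of \<open>\<nu>'\<close> from the denominator only
        enlarges the quotient and leaves a constant depending on \<open>\<nu>\<close> alone.\<close>
      have "d_TV \<nu> \<nu>' \<le> total_mass (\<nu> - \<nu>') / total_mass \<nu>"
        unfolding d_TV_def using \<nu>_pos total_mass_nonneg by (intro divide_left_mono) (auto simp: add_pos_nonneg)
      also have "\<dots> \<le> real N * L * K * d_TV \<mu>\<^sub>M \<mu>' / total_mass \<nu>"
        using le \<nu>_pos by (simp add: divide_right_mono)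
      also have "\<dots> \<le> C * d_TV \<mu>\<^sub>M \<mu>'" using d0 by (simp add: C_def distrib_right)
      finally show ?thesis .
    qed
  qed
  have "min (1 / 2) (\<delta> / K) > 0" using \<delta> K by simp
  then show ?thesis using C main by blast
qed

end
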